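(* Let $\hat{X}_s\in\mathbb{R}^{r\times r}$, $\hat{Y}_s\in\mathbb{R}^{r\times N_t}$, $\hat{Z}_s\in\mathbb{R}^{r\times N_t}$ and $\boldsymbol{\nu}_s\in\mathbb{R}^{p'}$ for $s=1,\ldots,N_s$. Then solutions to the convex minimization problem $$\operatorname*{arg\,min}_{\bar{\mathbf{T}}}\ \frac{1}{2}\sum_{s=1}^{N_s}\left\|\hat{Z}_s-\hat{X}_s(\bar{\mathbf{T}}\boldsymbol{\nu}_s)\hat{Y}_s\right\|^2\quad\text{s.t.}\quad \bar{\mathbf{T}}\boldsymbol{\eta}=\pm(\bar{\mathbf{T}}\boldsymbol{\eta})^{\mathsf{T}}\quad\forall\,\boldsymbol{\eta}\in\mathbb{R}^{p'}$$ (over tensors $\bar{\mathbf{T}}\in\mathbb{R}^{r\times r\times p'}$) can be computed by solving the linear system $$\sum_{s=1}^{N_s}\left[\boldsymbol{\nu}_s\boldsymbol{\nu}_s^{\mathsf{T}}\otimes_K\left(\hat{X}_s^{\mathsf{T}}\hat{X}_s\,\bar{\oplus}_K\,\hat{Y}_s\hat{Y}_s^{\mathsf{T}}\right)\right]\mathrm{vec}\,\bar{\mathbf{T}}=\sum_{s=1}^{N_s}\boldsymbol{\nu}_s\otimes_K\mathrm{cvec}_{12}\left(\hat{X}_s^{\mathsf{T}}\hat{Z}_s\hat{Y}_s^{\mathsf{T}}\pm\hat{Y}_s\hat{Z}_s^{\mathsf{T}}\hat{X}_s\right),$$ where the sign $\pm$ is the same in the constraint and in the linear system, $\mathrm{vec}\,\bar{\mathbf{T}}=\mathrm{cvec}_{12}(\mathrm{cvec}_{12}\,\bar{\mathbf{T}})$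 is the total column-wise flattening of the tensor $\bar{\mathbf{T}}\in\mathbb{R}^{r\times r\times p'}$, $\otimes_K$ denotes the usual Kronecker product of matrices, and $X\,\bar{\oplus}_K\,Y:=X\otimes_K Y+Y\otimes_K X$ denotes a symmetric Kronecker sum.
   Context: Here $r,p',N_t,N_s$ are positive integers and all indices start at 1. $\|F\|^2=\sum_{ij}F_{ij}F_{ij}$ is the squared Frobenius norm. For $\bar{\mathbf{T}}\in\mathbb{R}^{r\times r\times p'}$ and $\boldsymbol{\nu}\in\mathbb{R}^{p'}$, $\bar{\mathbf{T}}\boldsymbol{\nu}\in\mathbb{R}^{r\times r}$ is the contraction $(\bar{\mathbf{T}}\boldsymbol{\nu})_{ab}=\sum_{x=1}^{p'}\bar{\mathrm{T}}_{abx}\nu_x$. $\mathrm{cvec}_{12}$ merges the first two indices of a tensor column-wise into a single first index: for $\mathbf{B}\in\mathbb{R}^{N_1\times N_2\times\cdots}$, $(\mathrm{cvec}_{12}\mathbf{B})_{(k_2-1)N_1+k_1,\,k_3,\ldots}=\mathrm{B}_{k_1,k_2,k_3,\ldots}$; for a matrix it is the usual column-stacking vectorization. Consequently $\mathrm{vec}\,\bar{\mathbf{T}}\in\mathbb{R}^{r^2p'}$ has entries $(\mathrm{vec}\,\bar{\mathbf{T}})_{(x-1)r^2+(b-1)r+a}=\bar{\mathrm{T}}_{abx}$. The Kronecker product $\otimes_K$ is also applied to column vectors, regarded as one-column matrices. *)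

theory Defs
  imports Complex_Main "Jordan_Normal_Form.Matrix"
begin

text \<open>All indices are 0-based: the 1-based position
  \<open>(k\<^sub>2 - 1) N\<^sub>1 + k\<^sub>1\<close> becomes \<open>k\<^sub>2 N\<^sub>1 + k\<^sub>1\<close>.\<close>

definition frob_sq :: "real mat \<Rightarrow> real" where
  "frob_sq F = (\<Sum>i<dim_row F. \<Sum>j<dim_col F. F $$ (i,j) * F $$ (i,j))"

definition kron :: "real mat \<Rightarrow> real mat \<Rightarrow> real mat" (infixr \<open>\<otimes>\<^sub>K\<close> 70) where
  "A \<otimes>\<^sub>K B = mat (dim_row A * dim_row B) (dim_col A * dim_col B)
     (\<lambda>(i,j). A $$ (i div dim_row B, j div dim_col B) * B $$ (i mod dim_row B, j mod dim_col B))"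

definition sym_kron_sum :: "real mat \<Rightarrow> real mat \<Rightarrow> real mat" (infix \<open>\<oplus>\<^sub>K\<close> 67) where
  "A \<oplus>\<^sub>K B = A \<otimes>\<^sub>K B + B \<otimes>\<^sub>K A"

definition col_mat :: "real vec \<Rightarrow> real mat" where
  "col_mat v = mat_of_cols (dim_vec v) [v]"

definition kron_vec :: "real vec \<Rightarrow> real vec \<Rightarrow> real vec" where
  "kron_vec u v = col (col_mat u \<otimes>\<^sub>K col_mat v) 0"

definition finsum_mat :: "nat \<Rightarrow> nat \<Rightarrow> ('c \<Rightarrow> real mat) \<Rightarrow> 'c set \<Rightarrow> real mat" where
  "finsum_mat nr nc = finprod (monoid_mat TYPE(real) nr nc)"

text \<open>A tensor in \<open>\<real>\<^bsup>n\<^sub>1 \<times> n\<^sub>2 \<times> p\<^esup>\<close> is the \<open>p\<close>-vector of its \<open>n\<^sub>1 \<times> n\<^sub>2\<close> slices with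
  fixed last index: the entry at \<open>(a,b,x)\<close> is \<open>T $ x $$ (a,b)\<close>.\<close>

type_synonym tensor3 = "real mat vec"

definition carrier_tensor3 :: "nat \<Rightarrow> nat \<Rightarrow> nat \<Rightarrow> tensor3 set" where
  "carrier_tensor3 n1 n2 p = {T \<in> carrier_vec p. \<forall>x<p. T $ x \<in> carrier_mat n1 n2}"

definition contract :: "nat \<Rightarrow> nat \<Rightarrow> tensor3 \<Rightarrow> real vec \<Rightarrow> real mat" where
  "contract n1 n2 T \<eta> = mat n1 n2 (\<lambda>(a,b). \<Sum>x<dim_vec T. T $ x $$ (a,b) * \<eta> $ x)"

definition cvec12_mat :: "real mat \<Rightarrow> real vec" where
  "cvec12_mat B = vec (dim_row B * dim_col B) (\<lambda>k. B $$ (k mod dim_row B, k div dim_row B))"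

definition cvec12_tensor3 :: "nat \<Rightarrow> nat \<Rightarrow> tensor3 \<Rightarrow> real mat" where
  "cvec12_tensor3 n1 n2 T = mat (n1 * n2) (dim_vec T) (\<lambda>(k,x). T $ x $$ (k mod n1, k div n1))"

definition vec_tensor3 :: "nat \<Rightarrow> nat \<Rightarrow> tensor3 \<Rightarrow> real vec" where
  "vec_tensor3 n1 n2 T = cvec12_mat (cvec12_tensor3 n1 n2 T)"

lemma vec_tensor3_index:
  assumes "T \<in> carrier_tensor3 r r p" "a < r" "b < r" "x < p"
  shows "vec_tensor3 r r T $ (x * r\<^sup>2 + b * r + a) = T $ x $$ (a,b)"
proof -
  have dT: "dim_vec T = p" using assms(1) by (auto simp: carrier_tensor3_def)
  have 1: "b * r + a < r * r"
  proof -
    have "b * r + a < Suc b * r" using assms(2) by simp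
    also have "\<dots> \<le> r * r" using assms(3) by (intro mult_right_mono) auto
    finally show ?thesis .
  qed
  have 2: "x * (r * r) + (b * r + a) < (r * r) * p"
  proof -
    have "x * (r * r) + (b * r + a) < Suc x * (r * r)" using 1 by simp
    also have "\<dots> \<le> p * (r * r)" using assms(4) by (intro mult_right_mono) auto
    finally show ?thesis by (simp only: mult.commute)
  qed
  have eq: "x * r\<^sup>2 + b * r + a = x * (r * r) + (b * r + a)"
    by (simp add: power2_eq_square)
  have 3: "(x * (r * r) + (b * r + a)) mod (r * r) = b * r + a"
    "(x * (r * r) + (b * r + a)) div (r * r) = x"
    using 1 assms(2) by auto
  have 4: "(b * r + a) mod r = a" "(b * r + a) div r = b" using assms(2) by auto
  show ?thesis
    unfolding eq vec_tensor3_def cvec12_mat_def cvec12_tensor3_def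
    using 1 2 3 4 assms(4) by (simp add: dT)
qed

definition convex_comb :: "real \<Rightarrow> tensor3 \<Rightarrow> tensor3 \<Rightarrow> tensor3" where
  "convex_comb u T U = map_vec (\<lambda>M. (1 - u) \<cdot>\<^sub>m M) T + map_vec (\<lambda>M. u \<cdot>\<^sub>m M) U"

definition convex_problem :: "(tensor3 \<Rightarrow> real) \<Rightarrow> tensor3 set \<Rightarrow> bool" where
  "convex_problem f C \<longleftrightarrow> (\<forall>T\<in>C. \<forall>U\<in>C. \<forall>u\<in>{0..1}.
     convex_comb u T U \<in> C \<and> f (convex_comb u T U) \<le> (1 - u) * f T + u * f U)"

text \<open>The sign \<open>\<plusminus>\<close> is a real parameter \<open>\<sigma>\<close>, restricted to \<open>{1, -1}\<close> where it is used.\<close>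

definition feasible :: "real \<Rightarrow> nat \<Rightarrow> nat \<Rightarrow> tensor3 set" where
  "feasible \<sigma> r p = {T \<in> carrier_tensor3 r r p.
     \<forall>\<eta>\<in>carrier_vec p. contract r r T \<eta> = \<sigma> \<cdot>\<^sub>m transpose_mat (contract r r T \<eta>)}"

definition sym_part :: "real \<Rightarrow> tensor3 \<Rightarrow> tensor3" where
  "sym_part \<sigma> = map_vec (\<lambda>M. (1/2) \<cdot>\<^sub>m (M + \<sigma> \<cdot>\<^sub>m transpose_mat M))"

definition objective ::
  "nat \<Rightarrow> nat \<Rightarrow> (nat \<Rightarrow> real mat) \<Rightarrow> (nat \<Rightarrow> real mat) \<Rightarrow> (nat \<Rightarrow> real mat) \<Rightarrow>
    (nat \<Rightarrow> real vec) \<Rightarrow> tensor3 \<Rightarrow> real" where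
  "objective r Ns X Y Z \<nu> T =
     1/2 * (\<Sum>s\<in>{1..Ns}. frob_sq (Z s - X s * contract r r T (\<nu> s) * Y s))"

definition system_mat ::
  "nat \<Rightarrow> nat \<Rightarrow> nat \<Rightarrow> (nat \<Rightarrow> real mat) \<Rightarrow> (nat \<Rightarrow> real mat) \<Rightarrow>
    (nat \<Rightarrow> real vec) \<Rightarrow> real mat" where
  "system_mat r p Ns X Y \<nu> = finsum_mat (r\<^sup>2 * p) (r\<^sup>2 * p)
     (\<lambda>s. (col_mat (\<nu> s) * transpose_mat (col_mat (\<nu> s))) \<otimes>\<^sub>K
          ((transpose_mat (X s) * X s) \<oplus>\<^sub>K (Y s * transpose_mat (Y s)))) {1..Ns}"

definition system_rhs ::
  "real \<Rightarrow> nat \<Rightarrow> nat \<Rightarrow> nat \<Rightarrow> (nat \<Rightarrow> real mat) \<Rightarrow> (nat \<Rightarrow> real mat) \<Rightarrow>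
    (nat \<Rightarrow> real mat) \<Rightarrow> (nat \<Rightarrow> real vec) \<Rightarrow> real vec" where
  "system_rhs \<sigma> r p Ns X Y Z \<nu> = finsum_vec TYPE(real) (r\<^sup>2 * p)
     (\<lambda>s. kron_vec (\<nu> s)
        (cvec12_mat (transpose_mat (X s) * Z s * transpose_mat (Y s)
           + \<sigma> \<cdot>\<^sub>m (Y s * transpose_mat (Z s) * X s)))) {1..Ns}"

end

theory Submission
  imports Defs
begin

text \<open>The feasible set is the subspace of tensors with \<open>\<sigma>\<close>-symmetric slices, and for feasible \<open>T\<close> the
  linear system says that the slices of the gradient are \<open>\<sigma>\<close>-antisymmetric, i.e. orthogonal to that
  subspace. Hence the objective at any feasible \<open>U\<close> exceeds its value at a feasible solution \<open>T\<close> by half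
  the squared norm of \<open>X ((U - T) \<nu>) Y\<close>, so feasible solutions are minimizers, and any other minimizer
  has the same residuals and therefore solves the system too. The system is equivariant under
  \<open>\<sigma>\<close>-transposition of slices, so the symmetric part of any solution is again a solution.\<close>

subsection \<open>Block indices and Kronecker products\<close>

text \<open>The two terms of the symmetric Kronecker sum come from the constraint. Write
  \<open>P\<close>, \<open>Q\<close> for the Gram matrices of \<open>X\<close>, \<open>Y\<close> and
  \<open>C\<close> for a contracted tensor. The unconstrained gradient contains only
  \<open>P * C * Q\<close>; its component along the \<sigma>-symmetric matrices also needs \<sigma>
  times the transpose of this product, and substituting the constraint for the transpose of
  \<open>C\<close> turns that into \<open>Q * C * P\<close>. This substitution is valid only for
  feasible tensors, and the resulting system does not enforce the constraint: if all
  \<open>X s\<close> vanish, every tensor solves it. Hence the passage to \<open>sym_part\<close>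
  for arbitrary solutions. The system may be singular, so its solvability needs an argument of its
  own. It comes from the existence of least-squares projections, proved by a Gram-Schmidt induction
  that tolerates dependent columns. The same existence result is what makes every minimizer a
  solution, because a minimizer is compared with a known feasible solution.\<close>

lemma sum_mult_index:
  fixes f :: "nat \<Rightarrow> 'a :: comm_monoid_add"
  shows "(\<Sum>k<m * n. f k) = (\<Sum>i<m. \<Sum>j<n. f (i * n + j))"
proof -
  have "sum f {i * n..<i * n + n} = (\<Sum>j<n. f (i * n + j))" for i
    using sum.shift_bounds_nat_ivl[of f 0 "i * n" n]
    by (simp add: atLeast0LessThan add.commute)
  then show ?thesis
    using sum.nat_group[of f n m] by simp
qed

lemma mult_index_less:
  fixes i j m n :: nat
  assumes "i < m" "j < n"
  shows "i * n + j < m * n"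
proof -
  have "i * n + j < Suc i * n" using assms by simp
  also have "\<dots> \<le> m * n" using assms by (intro mult_right_mono) auto
  finally show ?thesis .
qed

text \<open>Applied twice, this splits an entrywise equation between flattened tensors into one over
  slice, column and row.\<close>

lemma all_mult_index_less:
  fixes m n :: nat
  shows "(\<forall>k<m * n. P k) \<longleftrightarrow> (\<forall>i<m. \<forall>j<n. P (i * n + j))"
proof (intro iffI allI impI)
  fix k
  assume P: "\<forall>i<m. \<forall>j<n. P (i * n + j)" and k: "k < m * n"
  then have "n > 0" by (cases n) auto
  moreover have "k div n < m" using k by (simp add: less_mult_imp_div_less)
  ultimately have "P (k div n * n + k mod n)" using P mod_less_divisor by blast
  then show "P k" by simp
qed (use mult_index_less in auto)

lemma index_mult_mat_sum:
  assumes "A \<in> carrier_mat m n" "B \<in> carrier_mat n l" "i < m" "j < l"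
  shows "(A * B) $$ (i,j) = (\<Sum>k<n. A $$ (i,k) * B $$ (k,j))"
  using assms by (auto simp: scalar_prod_def atLeast0LessThan intro!: sum.cong)

lemma index_mult_mat_triple:
  fixes A B D :: "'a :: comm_semiring_0 mat"
  assumes "A \<in> carrier_mat m n" "B \<in> carrier_mat n l" "D \<in> carrier_mat l k" "i < m" "j < k"
  shows "(A * B * D) $$ (i,j) = (\<Sum>a<n. \<Sum>b<l. A $$ (i,a) * B $$ (a,b) * D $$ (b,j))"
proof -
  have "(A * B * D) $$ (i,j) = (\<Sum>b<l. (\<Sum>a<n. A $$ (i,a) * B $$ (a,b)) * D $$ (b,j))"
    using assms by (subst index_mult_mat_sum[of _ m l]) (auto simp: index_mult_mat_sum[of A m n] intro!: sum.cong simp del: index_mult_mat(1))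
  also have "\<dots> = (\<Sum>a<n. \<Sum>b<l. A $$ (i,a) * B $$ (a,b) * D $$ (b,j))"
    by (subst sum.swap) (simp add: sum_distrib_right)
  finally show ?thesis .
qed

lemma index_mult_mat_vec_sum:
  assumes "A \<in> carrier_mat m n" "v \<in> carrier_vec n" "i < m"
  shows "(A *\<^sub>v v) $ i = (\<Sum>k<n. A $$ (i,k) * v $ k)"
  using assms by (auto simp: scalar_prod_def atLeast0LessThan intro!: sum.cong)

lemma finsum_mat_closed:
  assumes "\<And>s. s \<in> F \<Longrightarrow> M s \<in> carrier_mat m n"
  shows "finsum_mat m n M F \<in> carrier_mat m n"
  using comm_monoid.finprod_closed[OF comm_monoid_mat, of M F m n] assms
  by (auto simp: finsum_mat_def monoid_mat_def)

lemma index_finsum_mat: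
  assumes "finite F" "\<And>s. s \<in> F \<Longrightarrow> M s \<in> carrier_mat m n" "i < m" "j < n"
  shows "finsum_mat m n M F $$ (i,j) = (\<Sum>s\<in>F. M s $$ (i,j))"
proof -
  interpret comm_monoid "monoid_mat TYPE(real) m n" by (rule comm_monoid_mat)
  show ?thesis
    using assms(1,2)
  proof (induction F)
    case empty
    then show ?case using assms(3,4) by (simp add: finsum_mat_def) (simp add: monoid_mat_def)
  next
    case (insert s F)
    have "finsum_mat m n M (insert s F) = M s + finsum_mat m n M F"
      unfolding finsum_mat_def using insert
      by (subst finprod_insert) (auto simp: monoid_mat_def)
    moreover have "finsum_mat m n M F \<in> carrier_mat m n"
      using insert.prems by (intro finsum_mat_closed) auto
    ultimately show ?case using insert assms(3,4) by auto
  qed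
qed

lemma kron_carrier [simp]:
  "A \<in> carrier_mat m n \<Longrightarrow> B \<in> carrier_mat k l \<Longrightarrow> A \<otimes>\<^sub>K B \<in> carrier_mat (m * k) (n * l)"
  by (auto simp: kron_def)

lemma index_kron:
  assumes "A \<in> carrier_mat m n" "B \<in> carrier_mat k l" "i < m" "i' < k" "j < n" "j' < l"
  shows "(A \<otimes>\<^sub>K B) $$ (i * k + i', j * l + j') = A $$ (i,j) * B $$ (i',j')"
  using assms mult_index_less[of i m i' k] mult_index_less[of j n j' l] by (auto simp: kron_def)

lemma kron_mult_vec_index:
  assumes "A \<in> carrier_mat m n" "B \<in> carrier_mat k l" "i < m" "i' < k" "v \<in> carrier_vec (n * l)"
  shows "((A \<otimes>\<^sub>K B) *\<^sub>v v) $ (i * k + i') =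
    (\<Sum>j<n. \<Sum>j'<l. A $$ (i,j) * B $$ (i',j') * v $ (j * l + j'))"
  using assms mult_index_less[of i m i' k]
  by (subst index_mult_mat_vec_sum[of _ "m * k" "n * l"])
     (auto simp: sum_mult_index index_kron[of A m n B k l] intro!: sum.cong)

lemma sym_kron_sum_carrier [simp]:
  "A \<in> carrier_mat m m \<Longrightarrow> B \<in> carrier_mat m m \<Longrightarrow> A \<oplus>\<^sub>K B \<in> carrier_mat (m * m) (m * m)"
  by (simp add: sym_kron_sum_def)

lemma index_sym_kron_sum:
  assumes "A \<in> carrier_mat m m" "B \<in> carrier_mat m m" "i < m" "i' < m" "j < m" "j' < m"
  shows "(A \<oplus>\<^sub>K B) $$ (i * m + i', j * m + j') = A $$ (i,j) * B $$ (i',j') + B $$ (i,j) * A $$ (i',j')"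
proof -
  have "B \<otimes>\<^sub>K A \<in> carrier_mat (m * m) (m * m)" using assms by (intro kron_carrier)
  then have "(A \<oplus>\<^sub>K B) $$ (i * m + i', j * m + j') =
      (A \<otimes>\<^sub>K B) $$ (i * m + i', j * m + j') + (B \<otimes>\<^sub>K A) $$ (i * m + i', j * m + j')"
    using mult_index_less[of i m i' m] mult_index_less[of j m j' m] assms
    by (metis carrier_matD index_add_mat(1) sym_kron_sum_def)
  then show ?thesis
    using assms by (simp add: index_kron[of A m m B m m] index_kron[of B m m A m m])
qed

lemma col_mat_carrier [simp]: "v \<in> carrier_vec n \<Longrightarrow> col_mat v \<in> carrier_mat n 1"
  by (auto simp: col_mat_def)

lemma index_col_mat [simp]: "i < dim_vec v \<Longrightarrow> col_mat v $$ (i,0) = v $ i"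
  by (simp add: col_mat_def mat_of_cols_index)

lemma index_col_mat_outer:
  assumes "v \<in> carrier_vec n" "i < n" "j < n"
  shows "(col_mat v * transpose_mat (col_mat v)) $$ (i,j) = v $ i * v $ j"
proof -
  have c: "col_mat v \<in> carrier_mat n 1" using assms by (intro col_mat_carrier)
  show ?thesis using assms
    by (subst index_mult_mat_sum[OF c, of _ n]) (use c in auto)
qed

lemma kron_vec_carrier [simp]:
  "u \<in> carrier_vec m \<Longrightarrow> v \<in> carrier_vec n \<Longrightarrow> kron_vec u v \<in> carrier_vec (m * n)"
  unfolding kron_vec_def using kron_carrier[OF col_mat_carrier col_mat_carrier, of u m v n]
  by (metis carrier_matD(1) carrier_vec_dim_vec dim_col)

lemma index_kron_vec:
  assumes "u \<in> carrier_vec m" "v \<in> carrier_vec n" "i < m" "j < n"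
  shows "kron_vec u v $ (i * n + j) = u $ i * v $ j"
proof -
  have c: "col_mat u \<in> carrier_mat m 1" "col_mat v \<in> carrier_mat n 1" using assms by (intro col_mat_carrier; simp)+
  have k: "col_mat u \<otimes>\<^sub>K col_mat v \<in> carrier_mat (m * n) (1 * 1)" using c by (rule kron_carrier)
  then have "kron_vec u v $ (i * n + j) = (col_mat u \<otimes>\<^sub>K col_mat v) $$ (i * n + j, 0 * 1 + 0)"
    using assms mult_index_less[of i m j n] by (simp add: kron_vec_def)
  also have "\<dots> = u $ i * v $ j"
    using assms c by (subst index_kron[OF c]) auto
  finally show ?thesis .
qed

lemma cvec12_mat_carrier [simp]: "B \<in> carrier_mat m n \<Longrightarrow> cvec12_mat B \<in> carrier_vec (n * m)"
  by (auto simp: cvec12_mat_def)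

lemma index_cvec12_mat:
  assumes "B \<in> carrier_mat m n" "a < m" "b < n"
  shows "cvec12_mat B $ (b * m + a) = B $$ (a,b)"
  using assms mult_index_less[of b n a m] by (auto simp: cvec12_mat_def mult.commute)

lemma vec_tensor3_carrier:
  "T \<in> carrier_tensor3 r r p \<Longrightarrow> vec_tensor3 r r T \<in> carrier_vec (p * (r * r))"
  by (auto simp: vec_tensor3_def cvec12_tensor3_def cvec12_mat_def carrier_tensor3_def)

lemma sum_swap3:
  "(\<Sum>x\<in>A. \<Sum>b\<in>B. \<Sum>a\<in>D. f x a b) = (\<Sum>a\<in>D. \<Sum>b\<in>B. \<Sum>x\<in>A. f x a b)"
proof -
  have "(\<Sum>x\<in>A. \<Sum>b\<in>B. \<Sum>a\<in>D. f x a b) = (\<Sum>b\<in>B. \<Sum>x\<in>A. \<Sum>a\<in>D. f x a b)"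
    by (rule sum.swap)
  also have "\<dots> = (\<Sum>b\<in>B. \<Sum>a\<in>D. \<Sum>x\<in>A. f x a b)"
    by (rule sum.cong[OF refl], rule sum.swap)
  finally show ?thesis by (simp only: sum.swap[of _ D B])
qed

lemma mult_mat_triple_lincomb:
  fixes A :: "'a :: comm_ring_1 mat"
  assumes "A \<in> carrier_mat m n" "B \<in> carrier_mat n l" "B' \<in> carrier_mat n l" "D \<in> carrier_mat l k"
  shows "A * (\<alpha> \<cdot>\<^sub>m B + \<beta> \<cdot>\<^sub>m B') * D = \<alpha> \<cdot>\<^sub>m (A * B * D) + \<beta> \<cdot>\<^sub>m (A * B' * D)"
proof (rule eq_matI)
  fix i j
  assume "i < dim_row (\<alpha> \<cdot>\<^sub>m (A * B * D) + \<beta> \<cdot>\<^sub>m (A * B' * D))"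
    "j < dim_col (\<alpha> \<cdot>\<^sub>m (A * B * D) + \<beta> \<cdot>\<^sub>m (A * B' * D))"
  then have ij: "i < m" "j < k" using assms by auto
  have c: "\<alpha> \<cdot>\<^sub>m B + \<beta> \<cdot>\<^sub>m B' \<in> carrier_mat n l" using assms by simp
  have d: "A * B * D \<in> carrier_mat m k" "A * B' * D \<in> carrier_mat m k"
    using assms by (auto intro!: mult_carrier_mat simp del: assoc_mult_mat)
  have "(A * (\<alpha> \<cdot>\<^sub>m B + \<beta> \<cdot>\<^sub>m B') * D) $$ (i,j) =
      \<alpha> * (A * B * D) $$ (i,j) + \<beta> * (A * B' * D) $$ (i,j)"
    unfolding index_mult_mat_triple[OF assms(1) c assms(4) ij]
      index_mult_mat_triple[OF assms(1,2,4) ij] index_mult_mat_triple[OF assms(1,3,4) ij]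
      sum_distrib_left sum.distrib[symmetric]
    using assms by (intro sum.cong refl) (auto simp: algebra_simps)
  then show "(A * (\<alpha> \<cdot>\<^sub>m B + \<beta> \<cdot>\<^sub>m B') * D) $$ (i,j) =
      (\<alpha> \<cdot>\<^sub>m (A * B * D) + \<beta> \<cdot>\<^sub>m (A * B' * D)) $$ (i,j)"
    using d ij carrier_matD[OF d(1)] carrier_matD[OF d(2)]
    by (simp del: assoc_mult_mat index_mult_mat)
qed (use assms in auto)

lemma transpose_mult_triple:
  fixes A :: "'a :: comm_semiring_0 mat"
  assumes "A \<in> carrier_mat m n" "B \<in> carrier_mat n l" "D \<in> carrier_mat l k"
  shows "transpose_mat (A * B * D) = transpose_mat D * transpose_mat B * transpose_mat A"
proof -
  have "transpose_mat (A * B * D) = transpose_mat D * transpose_mat (A * B)"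
    using assms by (intro transpose_mult[of _ m l _ k]) auto
  also have "transpose_mat (A * B) = transpose_mat B * transpose_mat A"
    using assms by (intro transpose_mult) auto
  also have "transpose_mat D * (transpose_mat B * transpose_mat A) =
      transpose_mat D * transpose_mat B * transpose_mat A"
    using assms by (intro assoc_mult_mat[symmetric, of _ k l _ n _ m]) auto
  finally show ?thesis .
qed

subsection \<open>Frobenius inner product\<close>

definition frob_inner :: "real mat \<Rightarrow> real mat \<Rightarrow> real" where
  "frob_inner A B = (\<Sum>i<dim_row A. \<Sum>j<dim_col A. A $$ (i,j) * B $$ (i,j))"

lemma frob_sq_nonneg: "frob_sq A \<ge> 0"
  by (simp add: frob_sq_def sum_nonneg)

lemma frob_sq_eq_0_iff:
  assumes "A \<in> carrier_mat m n"
  shows "frob_sq A = 0 \<longleftrightarrow> A = 0\<^sub>m m n"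
proof
  assume "frob_sq A = 0"
  then have "\<forall>i<m. \<forall>j<n. A $$ (i,j) = 0"
    using assms by (auto simp: frob_sq_def sum_nonneg sum_nonneg_eq_0_iff)
  then show "A = 0\<^sub>m m n" using assms by (intro eq_matI) auto
qed (simp add: frob_sq_def)

lemma frob_sq_minus:
  assumes "A \<in> carrier_mat m n" "B \<in> carrier_mat m n"
  shows "frob_sq (A - B) = frob_sq A - 2 * frob_inner A B + frob_sq B"
  using assms
  by (simp add: frob_sq_def frob_inner_def sum_distrib_left flip: sum.distrib sum_subtractf)
     (intro sum.cong refl, auto simp: algebra_simps)

text \<open>The adjoint of the map \<open>D\<close> to \<open>X * D * Y\<close> for the Frobenius
  inner product. It moves the model map from the direction of variation to the residual.\<close>

lemma frob_inner_mult:
  assumes "A \<in> carrier_mat m k" "X \<in> carrier_mat m n" "D \<in> carrier_mat n l" "Y \<in> carrier_mat l k"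
  shows "frob_inner A (X * D * Y) = frob_inner (transpose_mat X * A * transpose_mat Y) D"
proof -
  have "frob_inner A (X * D * Y) =
      (\<Sum>i<m. \<Sum>j<k. \<Sum>a<n. \<Sum>b<l. A $$ (i,j) * X $$ (i,a) * D $$ (a,b) * Y $$ (b,j))"
    using assms
    by (auto simp: frob_inner_def index_mult_mat_triple[OF assms(2-4)] sum_distrib_left mult.assoc
        intro!: sum.cong simp del: index_mult_mat(1) assoc_mult_mat)
  also have "\<dots> = (\<Sum>i<m. \<Sum>a<n. \<Sum>b<l. \<Sum>j<k. A $$ (i,j) * X $$ (i,a) * D $$ (a,b) * Y $$ (b,j))"
    by (rule sum.cong[OF refl], subst sum.swap, rule sum.cong[OF refl], rule sum.swap)
  also have "\<dots> = (\<Sum>a<n. \<Sum>b<l. \<Sum>i<m. \<Sum>j<k. A $$ (i,j) * X $$ (i,a) * D $$ (a,b) * Y $$ (b,j))"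
    by (subst sum.swap, rule sum.cong[OF refl], rule sum.swap)
  also have "\<dots> = frob_inner (transpose_mat X * A * transpose_mat Y) D"
    using assms
    by (auto simp: frob_inner_def index_mult_mat_triple[of "transpose_mat X" n m A k "transpose_mat Y" l]
        sum_distrib_left sum_distrib_right mult_ac intro!: sum.cong simp del: index_mult_mat(1) assoc_mult_mat)
  finally show ?thesis .
qed

text \<open>Swapping the two indices multiplies each product of entries by
  \<open>- (\<sigma> * \<sigma>)\<close>, that is by -1, so the inner product equals its own
  negative.\<close>

lemma frob_inner_eq_0_antisym:
  assumes "K \<in> carrier_mat n n" "D \<in> carrier_mat n n" "\<sigma> * \<sigma> = (1::real)"
    and "transpose_mat D = \<sigma> \<cdot>\<^sub>m D" "transpose_mat K = (- \<sigma>) \<cdot>\<^sub>m K"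
  shows "frob_inner K D = 0"
proof -
  have e: "K $$ (j,i) * D $$ (j,i) = - (K $$ (i,j) * D $$ (i,j))" if "i < n" "j < n" for i j
  proof -
    have "transpose_mat K $$ (i,j) = ((- \<sigma>) \<cdot>\<^sub>m K) $$ (i,j)"
      "transpose_mat D $$ (i,j) = (\<sigma> \<cdot>\<^sub>m D) $$ (i,j)"
      by (simp_all only: assms(4,5))
    then have "K $$ (j,i) * D $$ (j,i) = (- \<sigma> * K $$ (i,j)) * (\<sigma> * D $$ (i,j))"
      using assms(1,2) that by simp
    also have "\<dots> = - (\<sigma> * \<sigma>) * (K $$ (i,j) * D $$ (i,j))" by (simp add: mult_ac)
    finally show ?thesis unfolding assms(3) by simp
  qed
  have "frob_inner K D = (\<Sum>i<n. \<Sum>j<n. K $$ (j,i) * D $$ (j,i))"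
    using assms(1) by (subst sum.swap) (simp add: frob_inner_def)
  also have "\<dots> = (\<Sum>i<n. \<Sum>j<n. - (K $$ (i,j) * D $$ (i,j)))"
    by (intro sum.cong refl e) auto
  also have "\<dots> = - frob_inner K D"
    using assms(1) by (simp add: frob_inner_def sum_negf)
  finally show ?thesis by simp
qed

subsection \<open>Normal equations\<close>

text \<open>Projection of \<open>z\<close> onto the span of finitely many, possibly dependent,
  columns \<open>M _ j\<close>. Since \<open>z\<close> is arbitrary in the induction, the hypothesis
  applies both to \<open>z\<close> and to the new column \<open>m\<close>; only the part of that
  column orthogonal to the earlier ones has to be treated.\<close>

lemma normal_equations_solvable:
  fixes M :: "'i \<Rightarrow> 'j \<Rightarrow> real"
  assumes "finite I" "finite J"
  shows "\<exists>c. \<forall>k\<in>J. (\<Sum>i\<in>I. (z i - (\<Sum>j\<in>J. c j * M i j)) * M i k) = 0"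
  using assms(2)
proof (induction J arbitrary: z)
  case empty
  show ?case by simp
next
  case (insert m J)
  obtain d where d: "\<And>k. k \<in> J \<Longrightarrow> (\<Sum>i\<in>I. (M i m - (\<Sum>j\<in>J. d j * M i j)) * M i k) = 0"
    using insert.IH[of "\<lambda>i. M i m"] by auto
  obtain c where c: "\<And>k. k \<in> J \<Longrightarrow> (\<Sum>i\<in>I. (z i - (\<Sum>j\<in>J. c j * M i j)) * M i k) = 0"
    using insert.IH[of z] by auto
  \<comment> \<open>\<open>q\<close> is what remains of the new column after projection,
    \<open>w\<close> what remains of \<open>z\<close>; both are orthogonal to all columns in
    \<open>J\<close>.\<close>
  define q where "q i = M i m - (\<Sum>j\<in>J. d j * M i j)" for i
  define w where "w i = z i - (\<Sum>j\<in>J. c j * M i j)" for i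
  \<comment> \<open>A vector orthogonal to the old columns does not distinguish column
    \<open>m\<close> from \<open>q\<close>, as the two differ by a combination of old
    columns.\<close>
  have orth: "(\<Sum>i\<in>I. u i * M i m) = (\<Sum>i\<in>I. u i * q i)"
    if "\<And>k. k \<in> J \<Longrightarrow> (\<Sum>i\<in>I. u i * M i k) = 0" for u
  proof -
    have "(\<Sum>i\<in>I. u i * (\<Sum>j\<in>J. d j * M i j)) = (\<Sum>j\<in>J. d j * (\<Sum>i\<in>I. u i * M i j))"
      unfolding sum_distrib_left by (subst sum.swap) (simp add: ac_simps)
    also have "\<dots> = 0" using that by simp
    finally show ?thesis by (simp add: q_def algebra_simps sum_subtractf)
  qed
  \<comment> \<open>The coefficient of \<open>w\<close> along \<open>q\<close>. If column
    \<open>m\<close> depends on the old ones, then \<open>q\<close> vanishes on \<open>I\<close> and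
    the quotient is 0 by the convention for division by zero, which is harmless.\<close>
  define t where "t = (\<Sum>i\<in>I. w i * q i) / (\<Sum>i\<in>I. q i * q i)"
  \<comment> \<open>Subtracting \<open>t * q\<close> from the residual amounts to giving column
    \<open>m\<close> the coefficient \<open>t\<close> and correcting the old coefficients by
    \<open>- t * d j\<close>.\<close>
  define c' where "c' = (\<lambda>j. c j - t * d j)(m := t)"
  have "(\<Sum>j\<in>insert m J. c' j * M i j) = t * M i m + (\<Sum>j\<in>J. (c j - t * d j) * M i j)" for i
    using insert.hyps by (auto simp: c'_def intro!: sum.cong)
  then have res: "z i - (\<Sum>j\<in>insert m J. c' j * M i j) = w i - t * q i" for i
    by (simp add: w_def q_def algebra_simps sum_subtractf sum_distrib_left)
  have J: "(\<Sum>i\<in>I. (w i - t * q i) * M i k) = 0" if "k \<in> J" for k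
  proof -
    have "(\<Sum>i\<in>I. (w i - t * q i) * M i k) = (\<Sum>i\<in>I. w i * M i k) - t * (\<Sum>i\<in>I. q i * M i k)"
      by (simp add: algebra_simps sum_subtractf sum_distrib_left)
    then show ?thesis using c[OF that] d[OF that] by (simp add: w_def q_def)
  qed
  have "(\<Sum>i\<in>I. w i * q i) = t * (\<Sum>i\<in>I. q i * q i)"
  proof (cases "(\<Sum>i\<in>I. q i * q i) = 0")
    case True
    then have "\<forall>i\<in>I. q i = 0" using assms(1) by (simp add: sum_nonneg_eq_0_iff)
    then show ?thesis by simp
  qed (simp add: t_def)
  moreover have "(\<Sum>i\<in>I. (w i - t * q i) * M i m) = (\<Sum>i\<in>I. (w i - t * q i) * q i)"
    by (rule orth) (rule J)
  ultimately have "(\<Sum>i\<in>I. (w i - t * q i) * M i m) = 0"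
    by (simp add: left_diff_distrib sum_subtractf sum_distrib_left mult.assoc)
  with J have "\<forall>k\<in>insert m J. (\<Sum>i\<in>I. (w i - t * q i) * M i k) = 0" by blast
  then show ?case unfolding res[symmetric] by (rule exI[of _ c'])
qed

subsection \<open>Tensors and their slices\<close>

lemma contract_carrier [simp]: "contract m n T \<eta> \<in> carrier_mat m n"
  by (simp add: contract_def)

lemma carrier_tensor3D:
  assumes "T \<in> carrier_tensor3 m n p"
  shows "dim_vec T = p" "x < p \<Longrightarrow> T $ x \<in> carrier_mat m n"
  using assms by (auto simp: carrier_tensor3_def)

lemma index_contract:
  "T \<in> carrier_tensor3 m n p \<Longrightarrow> a < m \<Longrightarrow> b < n \<Longrightarrow>
    contract m n T \<eta> $$ (a,b) = (\<Sum>x<p. T $ x $$ (a,b) * \<eta> $ x)"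
  by (simp add: contract_def carrier_tensor3D)

text \<open>Contraction with a unit vector extracts a single slice, so the constraint for all \<eta>
  forces each slice to be \<sigma>-symmetric; conversely, \<sigma>-symmetry passes to linear
  combinations of slices.\<close>

lemma feasible_iff:
  assumes "\<sigma> * \<sigma> = 1"
  shows "T \<in> feasible \<sigma> r p \<longleftrightarrow>
    T \<in> carrier_tensor3 r r p \<and> (\<forall>x<p. \<forall>a<r. \<forall>b<r. T $ x $$ (b,a) = \<sigma> * T $ x $$ (a,b))"
proof (intro iffI conjI allI impI)
  assume T: "T \<in> feasible \<sigma> r p"
  then show c: "T \<in> carrier_tensor3 r r p" by (simp add: feasible_def)
  fix x a b assume x: "x < p" and ab: "a < r" "b < r"
  have u: "contract r r T (unit_vec p x) $$ (i,j) = T $ x $$ (i,j)" if "i < r" "j < r" for i j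
  proof -
    have "contract r r T (unit_vec p x) $$ (i,j) = (\<Sum>y<p. if y = x then T $ x $$ (i,j) else 0)"
      unfolding index_contract[OF c that] using x by (intro sum.cong refl) auto
    then show ?thesis using x by simp
  qed
  have "contract r r T (unit_vec p x) = \<sigma> \<cdot>\<^sub>m transpose_mat (contract r r T (unit_vec p x))"
    using T unit_vec_carrier unfolding feasible_def by blast
  then have "contract r r T (unit_vec p x) $$ (b,a) =
      (\<sigma> \<cdot>\<^sub>m transpose_mat (contract r r T (unit_vec p x))) $$ (b,a)"
    by (rule arg_cong)
  also have "\<dots> = \<sigma> * contract r r T (unit_vec p x) $$ (a,b)"
    using ab contract_carrier[of r r T "unit_vec p x"]
    by (metis carrier_matD index_smult_mat(1) index_transpose_mat)
  finally show "T $ x $$ (b,a) = \<sigma> * T $ x $$ (a,b)" using ab by (simp add: u)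
next
  assume T: "T \<in> carrier_tensor3 r r p \<and> (\<forall>x<p. \<forall>a<r. \<forall>b<r. T $ x $$ (b,a) = \<sigma> * T $ x $$ (a,b))"
  then have c: "T \<in> carrier_tensor3 r r p" by simp
  have "contract r r T \<eta> = \<sigma> \<cdot>\<^sub>m transpose_mat (contract r r T \<eta>)" for \<eta>
  proof (rule eq_matI)
    fix i j
    assume "i < dim_row (\<sigma> \<cdot>\<^sub>m transpose_mat (contract r r T \<eta>))"
      "j < dim_col (\<sigma> \<cdot>\<^sub>m transpose_mat (contract r r T \<eta>))"
    then have ij: "i < r" "j < r" by (simp_all add: contract_def)
    have "T $ x $$ (i,j) = \<sigma> * T $ x $$ (j,i)" if "x < p" for x using T ij that by blast
    then have "contract r r T \<eta> $$ (i,j) = (\<Sum>x<p. \<sigma> * T $ x $$ (j,i) * \<eta> $ x)"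
      unfolding index_contract[OF c ij] by (intro sum.cong refl) simp
    also have "\<dots> = \<sigma> * contract r r T \<eta> $$ (j,i)"
      unfolding index_contract[OF c ij(2,1)] by (simp add: sum_distrib_left mult.assoc)
    finally show "contract r r T \<eta> $$ (i,j) = (\<sigma> \<cdot>\<^sub>m transpose_mat (contract r r T \<eta>)) $$ (i,j)"
      using ij by (simp add: contract_def)
  qed (simp_all add: contract_def)
  with c show "T \<in> feasible \<sigma> r p" unfolding feasible_def by blast
qed

lemma convex_comb_carrier:
  assumes "T \<in> carrier_tensor3 m n p" "U \<in> carrier_tensor3 m n p"
  shows "convex_comb u T U \<in> carrier_tensor3 m n p"
  using assms by (auto simp: carrier_tensor3_def convex_comb_def)

lemma index_convex_comb:
  assumes "T \<in> carrier_tensor3 m n p" "U \<in> carrier_tensor3 m n p" "x < p" "a < m" "b < n"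
  shows "convex_comb u T U $ x $$ (a,b) = (1 - u) * T $ x $$ (a,b) + u * U $ x $$ (a,b)"
  using assms carrier_tensor3D[OF assms(1)] carrier_tensor3D[OF assms(2)]
    carrier_matD[OF carrier_tensor3D(2)[OF assms(1,3)]]
    carrier_matD[OF carrier_tensor3D(2)[OF assms(2,3)]]
  by (simp add: convex_comb_def)

lemma contract_convex_comb:
  assumes "T \<in> carrier_tensor3 m n p" "U \<in> carrier_tensor3 m n p"
  shows "contract m n (convex_comb u T U) \<eta> = (1 - u) \<cdot>\<^sub>m contract m n T \<eta> + u \<cdot>\<^sub>m contract m n U \<eta>"
proof (rule eq_matI)
  fix i j
  assume "i < dim_row ((1 - u) \<cdot>\<^sub>m contract m n T \<eta> + u \<cdot>\<^sub>m contract m n U \<eta>)"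
    "j < dim_col ((1 - u) \<cdot>\<^sub>m contract m n T \<eta> + u \<cdot>\<^sub>m contract m n U \<eta>)"
  then have ij: "i < m" "j < n" by (simp_all add: contract_def)
  have "contract m n (convex_comb u T U) \<eta> $$ (i,j) =
      (\<Sum>x<p. (1 - u) * (T $ x $$ (i,j) * \<eta> $ x) + u * (U $ x $$ (i,j) * \<eta> $ x))"
    unfolding index_contract[OF convex_comb_carrier[OF assms] ij]
    using ij by (intro sum.cong refl) (simp add: index_convex_comb[OF assms] algebra_simps)
  also have "\<dots> = (1 - u) * contract m n T \<eta> $$ (i,j) + u * contract m n U \<eta> $$ (i,j)"
    unfolding index_contract[OF assms(1) ij] index_contract[OF assms(2) ij]
    by (simp add: sum.distrib sum_distrib_left)
  finally show "contract m n (convex_comb u T U) \<eta> $$ (i,j) =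
      ((1 - u) \<cdot>\<^sub>m contract m n T \<eta> + u \<cdot>\<^sub>m contract m n U \<eta>) $$ (i,j)"
    using ij by (simp add: contract_def)
qed (simp_all add: contract_def)

lemma sym_part_carrier:
  assumes "T \<in> carrier_tensor3 n n p"
  shows "sym_part \<sigma> T \<in> carrier_tensor3 n n p"
  using assms by (auto simp: carrier_tensor3_def sym_part_def)

lemma index_sym_part:
  assumes "T \<in> carrier_tensor3 n n p" "x < p" "a < n" "b < n"
  shows "sym_part \<sigma> T $ x $$ (a,b) = (T $ x $$ (a,b) + \<sigma> * T $ x $$ (b,a)) / 2"
  using assms by (auto simp: carrier_tensor3_def sym_part_def)

text \<open>With \<open>\<sigma> * \<sigma> = 1\<close>, multiplying the symmetrized entry by
  \<sigma> exchanges its two summands.\<close>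

lemma sym_part_feasible:
  assumes "T \<in> carrier_tensor3 r r p" "\<sigma> * \<sigma> = 1"
  shows "sym_part \<sigma> T \<in> feasible \<sigma> r p"
proof -
  have "\<sigma> * (\<sigma> * t) = t" for t unfolding mult.assoc[symmetric] assms(2) by simp
  then show ?thesis using assms
    by (simp add: feasible_iff sym_part_carrier index_sym_part ring_distribs)
qed

lemma contract_sym_part:
  assumes "T \<in> carrier_tensor3 n n p"
  shows "contract n n (sym_part \<sigma> T) \<eta> =
    (1/2) \<cdot>\<^sub>m contract n n T \<eta> + (\<sigma>/2) \<cdot>\<^sub>m transpose_mat (contract n n T \<eta>)"
proof (rule eq_matI)
  fix i j
  assume "i < dim_row ((1/2) \<cdot>\<^sub>m contract n n T \<eta> + (\<sigma>/2) \<cdot>\<^sub>m transpose_mat (contract n n T \<eta>))"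
    "j < dim_col ((1/2) \<cdot>\<^sub>m contract n n T \<eta> + (\<sigma>/2) \<cdot>\<^sub>m transpose_mat (contract n n T \<eta>))"
  then have ij: "i < n" "j < n" by (simp_all add: contract_def)
  have "contract n n (sym_part \<sigma> T) \<eta> $$ (i,j) =
      (\<Sum>x<p. (1/2) * (T $ x $$ (i,j) * \<eta> $ x) + (\<sigma>/2) * (T $ x $$ (j,i) * \<eta> $ x))"
    unfolding index_contract[OF sym_part_carrier[OF assms] ij]
    using ij by (intro sum.cong refl) (simp add: index_sym_part[OF assms] algebra_simps add_divide_distrib)
  also have "\<dots> = (1/2) * contract n n T \<eta> $$ (i,j) + (\<sigma>/2) * contract n n T \<eta> $$ (j,i)"
    unfolding index_contract[OF assms ij] index_contract[OF assms ij(2,1)]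
    by (simp only: sum.distrib sum_distrib_left)
  finally show "contract n n (sym_part \<sigma> T) \<eta> $$ (i,j) =
      ((1/2) \<cdot>\<^sub>m contract n n T \<eta> + (\<sigma>/2) \<cdot>\<^sub>m transpose_mat (contract n n T \<eta>)) $$ (i,j)"
    using ij by (simp add: contract_def)
qed (simp_all add: contract_def)

subsection \<open>The regression problem\<close>

text \<open>The sign enters only through its square, so both cases of the theorem are treated at
  once. Here \<open>n\<close> and \<open>N\<close> stand for the numbers of columns and of
  samples.\<close>

locale tensor_regression =
  fixes r p n N :: nat and \<sigma> :: real
    and X Y Z :: "nat \<Rightarrow> real mat" and \<nu> :: "nat \<Rightarrow> real vec"
  assumes sign_sq: "\<sigma> * \<sigma> = 1"
    and X: "s \<in> {1..N} \<Longrightarrow> X s \<in> carrier_mat r r"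
    and Y: "s \<in> {1..N} \<Longrightarrow> Y s \<in> carrier_mat r n"
    and Z: "s \<in> {1..N} \<Longrightarrow> Z s \<in> carrier_mat r n"
    and \<nu>: "s \<in> {1..N} \<Longrightarrow> \<nu> s \<in> carrier_vec p"
begin

definition P :: "nat \<Rightarrow> real mat" where "P s = transpose_mat (X s) * X s"
definition Q :: "nat \<Rightarrow> real mat" where "Q s = Y s * transpose_mat (Y s)"
definition W :: "nat \<Rightarrow> real mat" where "W s = transpose_mat (X s) * Z s * transpose_mat (Y s)"
definition C :: "tensor3 \<Rightarrow> nat \<Rightarrow> real mat" where "C T s = contract r r T (\<nu> s)"
definition R :: "tensor3 \<Rightarrow> nat \<Rightarrow> real mat" where "R T s = Z s - X s * C T s * Y s"
text \<open>The adjoint of the model map applied to the residual: minus the gradient of half the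
  squared residual of sample \<open>s\<close> with respect to the contracted matrix
  \<open>C T s\<close>.\<close>

definition H :: "tensor3 \<Rightarrow> nat \<Rightarrow> real mat" where
  "H T s = transpose_mat (X s) * R T s * transpose_mat (Y s)"

abbreviation solves_system :: "tensor3 \<Rightarrow> bool" where
  "solves_system T \<equiv> system_mat r p N X Y \<nu> *\<^sub>v vec_tensor3 r r T = system_rhs \<sigma> r p N X Y Z \<nu>"

lemma C_carrier [simp]: "C T s \<in> carrier_mat r r"
  by (simp add: C_def)

lemma PQW_carrier:
  assumes "s \<in> {1..N}"
  shows "P s \<in> carrier_mat r r" "Q s \<in> carrier_mat r r" "W s \<in> carrier_mat r r"
    "X s * C T s * Y s \<in> carrier_mat r n" "R T s \<in> carrier_mat r n" "H T s \<in> carrier_mat r r"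
  using X[OF assms] Y[OF assms] Z[OF assms] C_carrier[of T s]
  unfolding P_def Q_def W_def H_def R_def by (auto simp del: assoc_mult_mat)

lemma transpose_PQ:
  assumes "s \<in> {1..N}"
  shows "transpose_mat (P s) = P s" "transpose_mat (Q s) = Q s"
  using transpose_mult[of "transpose_mat (X s)" r r "X s" r] transpose_mult[of "Y s" r n "transpose_mat (Y s)" r]
    X[OF assms] Y[OF assms]
  unfolding P_def Q_def by auto

text \<open>Regrouping the factors exposes the Gram matrices that occur in the system, and separates
  the data term from the term linear in the tensor.\<close>

lemma H_eq:
  assumes s: "s \<in> {1..N}"
  shows "H T s = W s - P s * C T s * Q s"
proof -
  let ?X = "transpose_mat (X s)" and ?Y = "transpose_mat (Y s)"
  note c = X[OF s] Y[OF s] Z[OF s] C_carrier[of T s] PQW_carrier(4)[OF s, of T]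
  have "H T s = (?X * Z s - ?X * (X s * C T s * Y s)) * ?Y"
    unfolding H_def R_def using c by (subst mult_minus_distrib_mat[of _ r r _ n]) auto
  also have "\<dots> = W s - ?X * (X s * C T s * Y s) * ?Y"
    unfolding W_def using c
    by (subst minus_mult_distrib_mat[of _ r n]) (auto simp del: assoc_mult_mat intro!: mult_carrier_mat[of _ r r])
  also have "?X * (X s * C T s * Y s) * ?Y = P s * C T s * Q s"
  proof -
    have d: "X s * C T s \<in> carrier_mat r r" "?X \<in> carrier_mat r r" "?Y \<in> carrier_mat n r"
      using c by auto
    have "?X * (X s * C T s * Y s) * ?Y = ?X * (X s * C T s) * Y s * ?Y"
      using c d by (simp only: assoc_mult_mat[OF d(2,1) c(2)])
    also have "?X * (X s * C T s) = P s * C T s"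
      unfolding P_def using assoc_mult_mat[OF d(2) c(1,4)] by simp
    also have "P s * C T s * Y s * ?Y = P s * C T s * Q s"
      unfolding Q_def using PQW_carrier(1)[OF s] c d
      by (intro assoc_mult_mat[of _ r r _ n _ r]) auto
    finally show ?thesis .
  qed
  finally show ?thesis .
qed

text \<open>This is the identity that a Kronecker product of \<open>A\<close> and \<open>B\<close>
  sends the vectorization of \<open>M\<close> to that of \<open>B * M * transpose_mat A\<close>. The
  factor built from \<nu> contracts the slices to \<open>C T s\<close> and leaves the weight
  \<open>\<nu> s $ x\<close>; the symmetric sum yields the two triple products, free of transposes
  because \<open>P s\<close> and \<open>Q s\<close> are symmetric.\<close>

lemma system_mat_mult_index:
  assumes T: "T \<in> carrier_tensor3 r r p" and x: "x < p" and a: "a < r" and b: "b < r"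
  shows "(system_mat r p N X Y \<nu> *\<^sub>v vec_tensor3 r r T) $ (x * (r * r) + (b * r + a)) =
    (\<Sum>s\<in>{1..N}. \<nu> s $ x * ((P s * C T s * Q s) $$ (a,b) + (Q s * C T s * P s) $$ (a,b)))"
proof -
  define K where "K s = (col_mat (\<nu> s) * transpose_mat (col_mat (\<nu> s))) \<otimes>\<^sub>K (P s \<oplus>\<^sub>K Q s)" for s
  let ?v = "vec_tensor3 r r T" and ?k = "x * (r * r) + (b * r + a)"
  have v: "?v \<in> carrier_vec (p * (r * r))" using T by (rule vec_tensor3_carrier)
  have ba: "b * r + a < r * r" using a b by (intro mult_index_less)
  then have k: "?k < p * (r * r)" by (rule mult_index_less[OF x])
  have outer: "col_mat (\<nu> s) * transpose_mat (col_mat (\<nu> s)) \<in> carrier_mat p p" if "s \<in> {1..N}" for s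
    using col_mat_carrier[OF \<nu>[OF that]] by (intro mult_carrier_mat[of _ p 1]) auto
  have K: "K s \<in> carrier_mat (p * (r * r)) (p * (r * r))" if "s \<in> {1..N}" for s
    unfolding K_def using that by (intro kron_carrier sym_kron_sum_carrier outer PQW_carrier)
  have sys: "system_mat r p N X Y \<nu> = finsum_mat (p * (r * r)) (p * (r * r)) K {1..N}"
    unfolding system_mat_def K_def P_def Q_def by (simp add: power2_eq_square mult.commute)
  have fin: "finsum_mat (p * (r * r)) (p * (r * r)) K {1..N} \<in> carrier_mat (p * (r * r)) (p * (r * r))"
    using K by (rule finsum_mat_closed)
  have "(system_mat r p N X Y \<nu> *\<^sub>v ?v) $ ?k = (\<Sum>j<p * (r * r). (\<Sum>s\<in>{1..N}. K s $$ (?k,j)) * ?v $ j)"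
    unfolding sys index_mult_mat_vec_sum[OF fin v k]
    by (intro sum.cong refl) (simp only: index_finsum_mat[OF _ K k] lessThan_iff finite_atLeastAtMost)
  also have "\<dots> = (\<Sum>s\<in>{1..N}. (K s *\<^sub>v ?v) $ ?k)"
    unfolding sum_distrib_right using K
    by (subst sum.swap) (auto simp: index_mult_mat_vec_sum[OF _ v k] intro!: sum.cong)
  also have "\<dots> = (\<Sum>s\<in>{1..N}. \<nu> s $ x * ((P s * C T s * Q s) $$ (a,b) + (Q s * C T s * P s) $$ (a,b)))"
  proof (rule sum.cong[OF refl])
    fix s assume s: "s \<in> {1..N}"
    note c = PQW_carrier[OF s]
    have symP: "P s $$ (i,j) = P s $$ (j,i)" and symQ: "Q s $$ (i,j) = Q s $$ (j,i)" if "i < r" "j < r" for i j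
      using transpose_PQ[OF s] c(1,2) that by (metis carrier_matD index_transpose_mat(1))+
    define g where "g a' b' = P s $$ (a,a') * Q s $$ (b',b) + Q s $$ (a,a') * P s $$ (b',b)" for a' b'
    \<comment> \<open>In the flat index the slice is outermost, then the column, then the row. Hence
      the left Kronecker factor acts on columns and the right one on rows; \<open>g\<close> is the
      same kernel with the column factor transposed by symmetry, ready for a triple product.\<close>
    have "(K s *\<^sub>v ?v) $ ?k = (\<Sum>x'<p. \<Sum>b'<r. \<Sum>a'<r.
        (\<nu> s $ x * \<nu> s $ x') * (P s \<oplus>\<^sub>K Q s) $$ (b * r + a, b' * r + a') * ?v $ (x' * (r * r) + (b' * r + a')))"
      unfolding K_def kron_mult_vec_index[OF outer[OF s] sym_kron_sum_carrier[OF c(1,2)] x ba v] sum_mult_index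
      using \<nu>[OF s] x by (intro sum.cong refl) (simp add: index_col_mat_outer)
    also have "\<dots> = (\<Sum>x'<p. \<Sum>b'<r. \<Sum>a'<r. \<nu> s $ x * (T $ x' $$ (a',b') * \<nu> s $ x' * g a' b'))"
    proof (intro sum.cong refl)
      fix x' b' a' assume i: "x' \<in> {..<p}" "b' \<in> {..<r}" "a' \<in> {..<r}"
      have "?v $ (x' * (r * r) + (b' * r + a')) = T $ x' $$ (a',b')"
        using vec_tensor3_index[OF T, of a' b' x'] i by (simp add: power2_eq_square add.assoc)
      moreover have "(P s \<oplus>\<^sub>K Q s) $$ (b * r + a, b' * r + a') = g a' b'"
        using index_sym_kron_sum[OF c(1,2) b a, of b' a'] symP[of b b'] symQ[of b b'] i b
        by (simp add: g_def)
      ultimately show "(\<nu> s $ x * \<nu> s $ x') * (P s \<oplus>\<^sub>K Q s) $$ (b * r + a, b' * r + a') *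
          ?v $ (x' * (r * r) + (b' * r + a')) = \<nu> s $ x * (T $ x' $$ (a',b') * \<nu> s $ x' * g a' b')"
        by (simp only: mult_ac)
    qed
    also have "\<dots> = \<nu> s $ x * (\<Sum>a'<r. \<Sum>b'<r. C T s $$ (a',b') * g a' b')"
      by (subst sum_swap3)
        (simp add: sum_distrib_left sum_distrib_right C_def index_contract[OF T] mult.assoc)
    also have "(\<Sum>a'<r. \<Sum>b'<r. C T s $$ (a',b') * g a' b') =
        (P s * C T s * Q s) $$ (a,b) + (Q s * C T s * P s) $$ (a,b)"
      unfolding index_mult_mat_triple[OF c(1) C_carrier c(2) a b] index_mult_mat_triple[OF c(2) C_carrier c(1) a b]
        sum.distrib[symmetric] g_def by (simp add: algebra_simps)
    finally show "(K s *\<^sub>v ?v) $ ?k = \<nu> s $ x * ((P s * C T s * Q s) $$ (a,b) + (Q s * C T s * P s) $$ (a,b))" .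
  qed
  finally show ?thesis .
qed

lemma system_rhs_index:
  assumes x: "x < p" and a: "a < r" and b: "b < r"
  shows "system_rhs \<sigma> r p N X Y Z \<nu> $ (x * (r * r) + (b * r + a)) =
    (\<Sum>s\<in>{1..N}. \<nu> s $ x * (W s $$ (a,b) + \<sigma> * W s $$ (b,a)))"
proof -
  have ba: "b * r + a < r * r" using a b by (intro mult_index_less)
  then have k: "x * (r * r) + (b * r + a) < p * (r * r)" by (rule mult_index_less[OF x])
  define V where "V s = W s + \<sigma> \<cdot>\<^sub>m transpose_mat (W s)" for s
  \<comment> \<open>The second summand on the right-hand side is the transpose of the first, which
    is why its entries are those of \<open>W s\<close> with swapped indices.\<close>
  have W: "transpose_mat (W s) = Y s * transpose_mat (Z s) * X s" if "s \<in> {1..N}" for s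
    unfolding W_def using X[OF that] Y[OF that] Z[OF that]
    by (subst transpose_mult_triple[of _ r r _ n _ r]) auto
  have V: "V s \<in> carrier_mat r r" if "s \<in> {1..N}" for s
    using PQW_carrier(3)[OF that] by (simp add: V_def)
  have u: "kron_vec (\<nu> s) (cvec12_mat (V s)) \<in> carrier_vec (p * (r * r))" if "s \<in> {1..N}" for s
    using that by (intro kron_vec_carrier cvec12_mat_carrier \<nu> V)
  have "system_rhs \<sigma> r p N X Y Z \<nu> = finsum_vec TYPE(real) (p * (r * r)) (\<lambda>s. kron_vec (\<nu> s) (cvec12_mat (V s))) {1..N}"
  proof -
    interpret comm_monoid "monoid_vec TYPE(real) (p * (r * r))" by (rule comm_monoid_vec)
    show ?thesis
      unfolding system_rhs_def finsum_vec_def power2_eq_square mult.commute[of "r * r" p]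
    proof (rule finprod_cong')
      fix s assume "s \<in> {1..N}"
      from W[OF this] show "kron_vec (\<nu> s) (cvec12_mat (transpose_mat (X s) * Z s * transpose_mat (Y s)
          + \<sigma> \<cdot>\<^sub>m (Y s * transpose_mat (Z s) * X s))) = kron_vec (\<nu> s) (cvec12_mat (V s))"
        unfolding V_def by (simp only: W_def)
    qed (use u in \<open>auto simp: monoid_vec_def\<close>)
  qed
  also have "\<dots> $ (x * (r * r) + (b * r + a)) =
      (\<Sum>s\<in>{1..N}. kron_vec (\<nu> s) (cvec12_mat (V s)) $ (x * (r * r) + (b * r + a)))"
    using u k by (intro index_finsum_vec) auto
  also have "\<dots> = (\<Sum>s\<in>{1..N}. \<nu> s $ x * (W s $$ (a,b) + \<sigma> * W s $$ (b,a)))"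
  proof (intro sum.cong refl)
    fix s assume s: "s \<in> {1..N}"
    have "kron_vec (\<nu> s) (cvec12_mat (V s)) $ (x * (r * r) + (b * r + a)) = \<nu> s $ x * V s $$ (a,b)"
      using index_kron_vec[OF \<nu>[OF s] cvec12_mat_carrier[OF V[OF s]] x ba]
        index_cvec12_mat[OF V[OF s] a b] by simp
    then show "kron_vec (\<nu> s) (cvec12_mat (V s)) $ (x * (r * r) + (b * r + a)) =
        \<nu> s $ x * (W s $$ (a,b) + \<sigma> * W s $$ (b,a))"
      using PQW_carrier(3)[OF s] a b by (simp add: V_def)
  qed
  finally show ?thesis .
qed

text \<open>Here the Kronecker products disappear: all later arguments use this slicewise form of
  the system.\<close>

lemma solves_system_iff:
  assumes T: "T \<in> carrier_tensor3 r r p"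
  shows "solves_system T \<longleftrightarrow> (\<forall>x<p. \<forall>b<r. \<forall>a<r.
    (\<Sum>s\<in>{1..N}. \<nu> s $ x * ((P s * C T s * Q s) $$ (a,b) + (Q s * C T s * P s) $$ (a,b))) =
    (\<Sum>s\<in>{1..N}. \<nu> s $ x * (W s $$ (a,b) + \<sigma> * W s $$ (b,a))))"
proof -
  let ?l = "system_mat r p N X Y \<nu> *\<^sub>v vec_tensor3 r r T" and ?r = "system_rhs \<sigma> r p N X Y Z \<nu>"
  have c: "system_mat r p N X Y \<nu> \<in> carrier_mat (p * (r * r)) (p * (r * r))"
    unfolding system_mat_def power2_eq_square mult.commute[of "r * r" p]
    using PQW_carrier(1,2) col_mat_carrier[OF \<nu>]
    by (intro finsum_mat_closed kron_carrier sym_kron_sum_carrier mult_carrier_mat[of _ p 1])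
      (auto simp: P_def Q_def)
  have "kron_vec (\<nu> s) (cvec12_mat (transpose_mat (X s) * Z s * transpose_mat (Y s)
           + \<sigma> \<cdot>\<^sub>m (Y s * transpose_mat (Z s) * X s))) \<in> carrier_vec (p * (r * r))" if "s \<in> {1..N}" for s
    using X[OF that] Y[OF that] Z[OF that] \<nu>[OF that]
    by (intro kron_vec_carrier cvec12_mat_carrier) (auto simp del: assoc_mult_mat)
  then have "?r \<in> carrier_vec (p * (r * r))"
    unfolding system_rhs_def power2_eq_square mult.commute[of "r * r" p]
    by (intro finsum_vec_closed) auto
  with c have "solves_system T \<longleftrightarrow> (\<forall>k<p * (r * r). ?l $ k = ?r $ k)"
    by (auto simp del: index_mult_mat_vec intro!: eq_vecI)
  then show ?thesis
    unfolding all_mult_index_less by (simp add: system_mat_mult_index[OF T] system_rhs_index del: index_mult_mat_vec)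
qed

section \<open>Transposition of slices, the gradient and the system\<close>

lemma transpose_C_feasible:
  assumes "T \<in> feasible \<sigma> r p" "s \<in> {1..N}"
  shows "transpose_mat (C T s) = \<sigma> \<cdot>\<^sub>m C T s"
proof (rule eq_matI)
  fix i j assume "i < dim_row (\<sigma> \<cdot>\<^sub>m C T s)" "j < dim_col (\<sigma> \<cdot>\<^sub>m C T s)"
  then have ij: "i < r" "j < r" using C_carrier[of T s] by auto
  have T: "T \<in> carrier_tensor3 r r p" using assms(1) by (simp add: feasible_def)
  have "T $ x $$ (j,i) = \<sigma> * T $ x $$ (i,j)" if "x < p" for x
    using assms(1) ij that unfolding feasible_iff[OF sign_sq] by blast
  then have "C T s $$ (j,i) = \<sigma> * C T s $$ (i,j)"
    unfolding C_def index_contract[OF T ij] index_contract[OF T ij(2,1)] sum_distrib_left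
    by (intro sum.cong refl) simp
  then show "transpose_mat (C T s) $$ (i,j) = (\<sigma> \<cdot>\<^sub>m C T s) $$ (i,j)"
    using ij carrier_matD[OF C_carrier[of T s]] by simp
qed (use carrier_matD[OF C_carrier[of T s]] in simp_all)

text \<open>As \<open>P s\<close> and \<open>Q s\<close> are symmetric, transposing a triple product
  exchanges the outer factors. The sum of both products therefore commutes with transposition of
  \<open>C T s\<close>.\<close>

lemma index_PCQ_transpose:
  assumes s: "s \<in> {1..N}" and ab: "a < r" "b < r"
  shows "(P s * C T s * Q s) $$ (b,a) = (Q s * transpose_mat (C T s) * P s) $$ (a,b)"
    and "(Q s * C T s * P s) $$ (b,a) = (P s * transpose_mat (C T s) * Q s) $$ (a,b)"
proof -
  note c = PQW_carrier(1,2)[OF s]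
  have d: "P s * C T s * Q s \<in> carrier_mat r r" "Q s * C T s * P s \<in> carrier_mat r r"
    using c by (auto intro!: mult_carrier_mat simp del: assoc_mult_mat)
  have "(P s * C T s * Q s) $$ (b,a) = transpose_mat (P s * C T s * Q s) $$ (a,b)"
    "(Q s * C T s * P s) $$ (b,a) = transpose_mat (Q s * C T s * P s) $$ (a,b)"
    using ab carrier_matD[OF d(1)] carrier_matD[OF d(2)]
    by (metis index_transpose_mat(1))+
  then show "(P s * C T s * Q s) $$ (b,a) = (Q s * transpose_mat (C T s) * P s) $$ (a,b)"
    and "(Q s * C T s * P s) $$ (b,a) = (P s * transpose_mat (C T s) * Q s) $$ (a,b)"
    unfolding transpose_mult_triple[OF c(1) C_carrier c(2)] transpose_mult_triple[OF c(2) C_carrier c(1)]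
      transpose_PQ[OF s] by simp_all
qed

text \<open>Slice \<open>x\<close> of minus the gradient of the objective on all of \<open>\<real>\<^bsup>r \<times> r \<times> p\<^esup>\<close>.\<close>

definition neg_grad :: "tensor3 \<Rightarrow> nat \<Rightarrow> real mat" where
  "neg_grad T x = mat r r (\<lambda>(a,b). \<Sum>s\<in>{1..N}. \<nu> s $ x * H T s $$ (a,b))"

lemma neg_grad_carrier [simp]: "neg_grad T x \<in> carrier_mat r r"
  by (simp add: neg_grad_def)

text \<open>For feasible \<open>T\<close>, \<sigma> times the transpose of
  \<open>P s * C T s * Q s\<close> is \<open>\<sigma> * \<sigma>\<close> times
  \<open>Q s * C T s * P s\<close>. So adding to \<open>H T s\<close> its \<sigma>-transpose gives
  exactly the difference of the two sides of the system.\<close>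

lemma solves_system_feasible_iff:
  assumes "T \<in> feasible \<sigma> r p"
  shows "solves_system T \<longleftrightarrow> (\<forall>x<p. \<forall>b<r. \<forall>a<r. neg_grad T x $$ (a,b) + \<sigma> * neg_grad T x $$ (b,a) = 0)"
proof -
  have T: "T \<in> carrier_tensor3 r r p" using assms by (simp add: feasible_def)
  have eq: "neg_grad T x $$ (a,b) + \<sigma> * neg_grad T x $$ (b,a) =
      (\<Sum>s\<in>{1..N}. \<nu> s $ x * (W s $$ (a,b) + \<sigma> * W s $$ (b,a))) -
      (\<Sum>s\<in>{1..N}. \<nu> s $ x * ((P s * C T s * Q s) $$ (a,b) + (Q s * C T s * P s) $$ (a,b)))"
    if ab: "a < r" "b < r" for x a b
  proof -
    have "H T s $$ (a,b) + \<sigma> * H T s $$ (b,a) =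
      (W s $$ (a,b) + \<sigma> * W s $$ (b,a)) - ((P s * C T s * Q s) $$ (a,b) + (Q s * C T s * P s) $$ (a,b))"
      if s: "s \<in> {1..N}" for s
    proof -
      note c = PQW_carrier(1,2)[OF s]
      have d: "P s * C T s * Q s \<in> carrier_mat r r" "Q s * C T s * P s \<in> carrier_mat r r"
        using c by (auto intro!: mult_carrier_mat simp del: assoc_mult_mat)
      have h: "H T s $$ (i,j) = W s $$ (i,j) - (P s * C T s * Q s) $$ (i,j)" if "i < r" "j < r" for i j
        unfolding H_eq[OF s] using d(1) that by (metis carrier_matD index_minus_mat(1))
      have "Q s * (\<sigma> \<cdot>\<^sub>m C T s) * P s = \<sigma> \<cdot>\<^sub>m (Q s * C T s * P s)"
        using mult_smult_distrib[OF c(2) C_carrier] mult_smult_assoc_mat[OF mult_carrier_mat[OF c(2) C_carrier] c(1)]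
        by simp
      then have "(P s * C T s * Q s) $$ (b,a) = (\<sigma> \<cdot>\<^sub>m (Q s * C T s * P s)) $$ (a,b)"
        using index_PCQ_transpose(1)[OF s ab, of T] transpose_C_feasible[OF assms s] by simp
      also have "\<dots> = \<sigma> * (Q s * C T s * P s) $$ (a,b)"
        using ab d(2) by (metis carrier_matD index_smult_mat(1))
      finally have "\<sigma> * (P s * C T s * Q s) $$ (b,a) = \<sigma> * \<sigma> * (Q s * C T s * P s) $$ (a,b)"
        by (simp only: mult.assoc)
      then show ?thesis unfolding h[OF ab] h[OF ab(2,1)] right_diff_distrib sign_sq by simp
    qed
    then have "(\<Sum>s\<in>{1..N}. \<nu> s $ x * (H T s $$ (a,b) + \<sigma> * H T s $$ (b,a))) =
      (\<Sum>s\<in>{1..N}. \<nu> s $ x * ((W s $$ (a,b) + \<sigma> * W s $$ (b,a)) -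
        ((P s * C T s * Q s) $$ (a,b) + (Q s * C T s * P s) $$ (a,b))))"
      by (intro sum.cong refl) simp
    moreover have "neg_grad T x $$ (a,b) + \<sigma> * neg_grad T x $$ (b,a) =
      (\<Sum>s\<in>{1..N}. \<nu> s $ x * (H T s $$ (a,b) + \<sigma> * H T s $$ (b,a)))"
      using ab by (simp add: neg_grad_def distrib_left sum.distrib sum_distrib_left mult_ac)
    ultimately show ?thesis by (simp only: right_diff_distrib sum_subtractf)
  qed
  show ?thesis unfolding solves_system_iff[OF T] using eq by (auto simp del: index_mult_mat(1) assoc_mult_mat)
qed

text \<open>The left side commutes with transposing slices and the right side is already
  \<sigma>-symmetric. Averaging the equations at \<open>(a,b)\<close> and \<open>(b,a)\<close> with
  weights \<open>1/2\<close> and \<open>\<sigma>/2\<close> thus gives the system for the symmetrized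
  tensor.\<close>

lemma solves_system_sym_part:
  assumes T: "T \<in> carrier_tensor3 r r p" and sol: "solves_system T"
  shows "solves_system (sym_part \<sigma> T)"
  unfolding solves_system_iff[OF sym_part_carrier[OF T]]
proof (intro allI impI)
  fix x a b assume x: "x < p" and b: "b < r" and a: "a < r"
  define L where "L s i j = (P s * C T s * Q s) $$ (i,j) + (Q s * C T s * P s) $$ (i,j)" for s i j
  define V where "V s i j = W s $$ (i,j) + \<sigma> * W s $$ (j,i)" for s i j
  have LV: "(\<Sum>s\<in>{1..N}. \<nu> s $ x * L s i j) = (\<Sum>s\<in>{1..N}. \<nu> s $ x * V s i j)" if "i < r" "j < r" for i j
    using sol that x unfolding solves_system_iff[OF T] L_def V_def by blast
  have "(P s * C (sym_part \<sigma> T) s * Q s) $$ (a,b) + (Q s * C (sym_part \<sigma> T) s * P s) $$ (a,b) =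
      1/2 * L s a b + \<sigma>/2 * L s b a" if s: "s \<in> {1..N}" for s
  proof -
    note c = PQW_carrier(1,2)[OF s]
    have t: "transpose_mat (C T s) \<in> carrier_mat r r" by simp
    have C: "C (sym_part \<sigma> T) s = (1/2) \<cdot>\<^sub>m C T s + (\<sigma>/2) \<cdot>\<^sub>m transpose_mat (C T s)"
      unfolding C_def by (rule contract_sym_part[OF T])
    have e: "(A * C (sym_part \<sigma> T) s * B) $$ (a,b) =
        1/2 * (A * C T s * B) $$ (a,b) + \<sigma>/2 * (A * transpose_mat (C T s) * B) $$ (a,b)"
      if A: "A \<in> carrier_mat r r" and B: "B \<in> carrier_mat r r" for A B
    proof -
      have "A * C T s * B \<in> carrier_mat r r" "A * transpose_mat (C T s) * B \<in> carrier_mat r r"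
        using A B t by (auto intro!: mult_carrier_mat simp del: assoc_mult_mat)
      note d = carrier_matD[OF this(1)] carrier_matD[OF this(2)]
      show ?thesis
        unfolding C mult_mat_triple_lincomb[OF A C_carrier t B]
        using a b d by (simp del: index_mult_mat assoc_mult_mat)
    qed
    show ?thesis
      unfolding e[OF c] e[OF c(2,1)] L_def index_PCQ_transpose[OF s a b] by (simp add: algebra_simps)
  qed
  then have "(\<Sum>s\<in>{1..N}. \<nu> s $ x * ((P s * C (sym_part \<sigma> T) s * Q s) $$ (a,b) +
        (Q s * C (sym_part \<sigma> T) s * P s) $$ (a,b))) =
      (\<Sum>s\<in>{1..N}. \<nu> s $ x * (1/2 * L s a b + \<sigma>/2 * L s b a))"
    by (intro sum.cong refl) simp
  also have "\<dots> = 1/2 * (\<Sum>s\<in>{1..N}. \<nu> s $ x * L s a b) + \<sigma>/2 * (\<Sum>s\<in>{1..N}. \<nu> s $ x * L s b a)"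
    by (simp add: distrib_left sum.distrib sum_distrib_left mult_ac)
  also have "\<dots> = (\<Sum>s\<in>{1..N}. \<nu> s $ x * (1/2 * V s a b + \<sigma>/2 * V s b a))"
    unfolding LV[OF a b] LV[OF b a] by (simp add: distrib_left sum.distrib sum_distrib_left mult_ac)
  \<comment> \<open>The averaging fixes \<open>V s\<close> because
    \<open>\<sigma> * \<sigma> = 1\<close>.\<close>
  also have "\<dots> = (\<Sum>s\<in>{1..N}. \<nu> s $ x * V s a b)"
  proof (intro sum.cong refl)
    fix s
    have "1/2 * V s a b + \<sigma>/2 * V s b a =
        1/2 * W s $$ (a,b) + \<sigma> * W s $$ (b,a) + (\<sigma> * \<sigma>)/2 * W s $$ (a,b)"
      unfolding V_def by (simp add: algebra_simps)
    then show "\<nu> s $ x * (1/2 * V s a b + \<sigma>/2 * V s b a) = \<nu> s $ x * V s a b"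
      unfolding sign_sq V_def by simp
  qed
  finally show "(\<Sum>s\<in>{1..N}. \<nu> s $ x * ((P s * C (sym_part \<sigma> T) s * Q s) $$ (a,b) +
        (Q s * C (sym_part \<sigma> T) s * P s) $$ (a,b))) =
      (\<Sum>s\<in>{1..N}. \<nu> s $ x * (W s $$ (a,b) + \<sigma> * W s $$ (b,a)))"
    by (simp only: V_def)
qed

section \<open>First-order condition\<close>

lemma objective_eq: "objective r N X Y Z \<nu> T = 1/2 * (\<Sum>s\<in>{1..N}. frob_sq (R T s))"
  by (simp add: objective_def R_def C_def)

text \<open>Both sides are minus the derivative of the objective at \<open>T\<close> in direction
  \<open>D\<close>, once in terms of residuals and once in terms of slices. Besides the adjoint of
  the model map, this uses that contraction with \<nu> is adjoint to weighting by the entries of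
  \<nu>.\<close>

lemma sum_frob_inner_neg_grad:
  assumes "T \<in> carrier_tensor3 r r p" and D: "D \<in> carrier_tensor3 r r p"
  shows "(\<Sum>s\<in>{1..N}. frob_inner (R T s) (X s * C D s * Y s)) = (\<Sum>x<p. frob_inner (neg_grad T x) (D $ x))"
proof -
  have "(\<Sum>s\<in>{1..N}. frob_inner (R T s) (X s * C D s * Y s)) = (\<Sum>s\<in>{1..N}. frob_inner (H T s) (C D s))"
  proof (intro sum.cong refl)
    fix s assume s: "s \<in> {1..N}"
    show "frob_inner (R T s) (X s * C D s * Y s) = frob_inner (H T s) (C D s)"
      unfolding H_def by (rule frob_inner_mult[OF PQW_carrier(5)[OF s] X[OF s] C_carrier Y[OF s]])
  qed
  also have "\<dots> = (\<Sum>s\<in>{1..N}. \<Sum>a<r. \<Sum>b<r. \<Sum>x<p. \<nu> s $ x * H T s $$ (a,b) * D $ x $$ (a,b))"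
  proof (intro sum.cong refl)
    fix s assume s: "s \<in> {1..N}"
    have "H T s \<in> carrier_mat r r" using s by (rule PQW_carrier)
    then show "frob_inner (H T s) (C D s) = (\<Sum>a<r. \<Sum>b<r. \<Sum>x<p. \<nu> s $ x * H T s $$ (a,b) * D $ x $$ (a,b))"
      by (auto simp: frob_inner_def C_def index_contract[OF D] sum_distrib_left mult_ac intro!: sum.cong)
  qed
  also have "\<dots> = (\<Sum>s\<in>{1..N}. \<Sum>x<p. \<Sum>a<r. \<Sum>b<r. \<nu> s $ x * H T s $$ (a,b) * D $ x $$ (a,b))"
    by (rule sum.cong[OF refl], subst sum_swap3, subst sum.swap[of _ "{..<r}" "{..<r}"],
        subst sum.swap[of _ "{..<r}" "{..<r}"], rule sum.cong[OF refl], rule sum.swap)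
  also have "\<dots> = (\<Sum>x<p. \<Sum>a<r. \<Sum>b<r. \<Sum>s\<in>{1..N}. \<nu> s $ x * H T s $$ (a,b) * D $ x $$ (a,b))"
    by (subst sum.swap, rule sum.cong[OF refl], subst sum.swap, rule sum.cong[OF refl], rule sum.swap)
  also have "\<dots> = (\<Sum>x<p. frob_inner (neg_grad T x) (D $ x))"
    by (simp add: frob_inner_def neg_grad_def sum_distrib_right)
  finally show ?thesis .
qed

text \<open>Slicewise, a \<sigma>-antisymmetric gradient meets a \<sigma>-symmetric direction, so
  every inner product vanishes.\<close>

lemma sum_frob_inner_eq_0:
  assumes T: "T \<in> feasible \<sigma> r p" "solves_system T" and D: "D \<in> feasible \<sigma> r p"
  shows "(\<Sum>s\<in>{1..N}. frob_inner (R T s) (X s * C D s * Y s)) = 0"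
proof -
  have c: "T \<in> carrier_tensor3 r r p" "D \<in> carrier_tensor3 r r p"
    using T(1) D by (simp_all add: feasible_def)
  have "frob_inner (neg_grad T x) (D $ x) = 0" if x: "x < p" for x
  proof (rule frob_inner_eq_0_antisym[OF neg_grad_carrier carrier_tensor3D(2)[OF c(2) x] sign_sq])
    note d = carrier_matD[OF carrier_tensor3D(2)[OF c(2) x]] carrier_matD[OF neg_grad_carrier[of T x]]
    show "transpose_mat (D $ x) = \<sigma> \<cdot>\<^sub>m D $ x"
    proof (rule eq_matI)
      fix i j assume "i < dim_row (\<sigma> \<cdot>\<^sub>m D $ x)" "j < dim_col (\<sigma> \<cdot>\<^sub>m D $ x)"
      then have ij: "i < r" "j < r" using d by auto
      then have "D $ x $$ (j,i) = \<sigma> * D $ x $$ (i,j)"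
        using D x unfolding feasible_iff[OF sign_sq] by blast
      then show "transpose_mat (D $ x) $$ (i,j) = (\<sigma> \<cdot>\<^sub>m D $ x) $$ (i,j)"
        using ij d by simp
    qed (use d in auto)
    show "transpose_mat (neg_grad T x) = (- \<sigma>) \<cdot>\<^sub>m neg_grad T x"
    proof (rule eq_matI)
      fix i j assume "i < dim_row ((- \<sigma>) \<cdot>\<^sub>m neg_grad T x)" "j < dim_col ((- \<sigma>) \<cdot>\<^sub>m neg_grad T x)"
      then have ij: "i < r" "j < r" using d by auto
      then have "neg_grad T x $$ (j,i) + \<sigma> * neg_grad T x $$ (i,j) = 0"
        using T x unfolding solves_system_feasible_iff[OF T(1)] by blast
      then show "transpose_mat (neg_grad T x) $$ (i,j) = ((- \<sigma>) \<cdot>\<^sub>m neg_grad T x) $$ (i,j)"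
        using ij d by simp
    qed (use d in auto)
  qed
  then show ?thesis unfolding sum_frob_inner_neg_grad[OF c] by simp
qed

section \<open>Convexity of the problem\<close>

lemma convex_comb_feasible:
  assumes "T \<in> feasible \<sigma> r p" "U \<in> feasible \<sigma> r p"
  shows "convex_comb u T U \<in> feasible \<sigma> r p"
proof -
  have c: "T \<in> carrier_tensor3 r r p" "U \<in> carrier_tensor3 r r p"
    using assms by (simp_all add: feasible_def)
  have "convex_comb u T U $ x $$ (b,a) = \<sigma> * convex_comb u T U $ x $$ (a,b)"
    if "x < p" "a < r" "b < r" for x a b
  proof -
    have "T $ x $$ (b,a) = \<sigma> * T $ x $$ (a,b)" "U $ x $$ (b,a) = \<sigma> * U $ x $$ (a,b)"
      using assms that unfolding feasible_iff[OF sign_sq] by blast+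
    then show ?thesis
      unfolding index_convex_comb[OF c that] index_convex_comb[OF c that(1,3,2)]
      by (simp add: algebra_simps)
  qed
  then show ?thesis using convex_comb_carrier[OF c] unfolding feasible_iff[OF sign_sq] by blast
qed

lemma model_convex_comb:
  assumes "T \<in> carrier_tensor3 r r p" "U \<in> carrier_tensor3 r r p" "s \<in> {1..N}"
  shows "X s * C (convex_comb u T U) s * Y s = (1 - u) \<cdot>\<^sub>m (X s * C T s * Y s) + u \<cdot>\<^sub>m (X s * C U s * Y s)"
  using mult_mat_triple_lincomb[OF X[OF assms(3)] C_carrier C_carrier Y[OF assms(3)]]
  by (simp only: C_def contract_convex_comb[OF assms(1,2)])

lemma R_convex_comb:
  assumes "T \<in> carrier_tensor3 r r p" "U \<in> carrier_tensor3 r r p" "s \<in> {1..N}"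
  shows "R (convex_comb u T U) s = (1 - u) \<cdot>\<^sub>m R T s + u \<cdot>\<^sub>m R U s"
proof -
  have c: "X s * C T s * Y s \<in> carrier_mat r n" "X s * C U s * Y s \<in> carrier_mat r n"
    using assms(3) by (rule PQW_carrier)+
  show ?thesis
    unfolding R_def model_convex_comb[OF assms]
    using carrier_matD[OF c(1)] carrier_matD[OF c(2)] Z[OF assms(3)]
    by (intro eq_matI) (auto simp: algebra_simps simp del: index_mult_mat assoc_mult_mat)
qed

text \<open>Residuals are affine in the tensor, so the inequality reduces to convexity of the
  square, entry by entry.\<close>

lemma convex_problem_objective:
  "convex_problem (objective r N X Y Z \<nu>) (feasible \<sigma> r p)"
  unfolding convex_problem_def
proof (intro ballI conjI)
  fix T U and u :: real
  assume f: "T \<in> feasible \<sigma> r p" "U \<in> feasible \<sigma> r p" and u: "u \<in> {0..1}"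
  then show "convex_comb u T U \<in> feasible \<sigma> r p" by (intro convex_comb_feasible)
  have c: "T \<in> carrier_tensor3 r r p" "U \<in> carrier_tensor3 r r p"
    using f by (simp_all add: feasible_def)
  have sq: "((1 - u) * x + u * y) * ((1 - u) * x + u * y) \<le> (1 - u) * (x * x) + u * (y * y)" for x y :: real
  proof -
    have "(1 - u) * (x * x) + u * (y * y) - ((1 - u) * x + u * y) * ((1 - u) * x + u * y) =
        u * (1 - u) * ((x - y) * (x - y))"
      by (simp add: algebra_simps)
    moreover have "\<dots> \<ge> 0" using u by simp
    ultimately show ?thesis by linarith
  qed
  have "frob_sq (R (convex_comb u T U) s) \<le> (1 - u) * frob_sq (R T s) + u * frob_sq (R U s)"
    if s: "s \<in> {1..N}" for s
  proof -
    note d = carrier_matD[OF PQW_carrier(5)[OF s]]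
    show ?thesis
      unfolding R_convex_comb[OF c s] frob_sq_def sum_distrib_left
      using d by (simp flip: sum.distrib) (intro sum_mono sq)
  qed
  then have "(\<Sum>s\<in>{1..N}. frob_sq (R (convex_comb u T U) s)) \<le>
      (\<Sum>s\<in>{1..N}. (1 - u) * frob_sq (R T s) + u * frob_sq (R U s))"
    by (rule sum_mono)
  then show "objective r N X Y Z \<nu> (convex_comb u T U) \<le>
      (1 - u) * objective r N X Y Z \<nu> T + u * objective r N X Y Z \<nu> U"
    unfolding objective_eq sum.distrib sum_distrib_left[symmetric] by argo
qed

text \<open>Pythagoras: the residual at \<open>U\<close> is the residual at \<open>T\<close> minus
  the change of the model values, and the first-order condition removes the cross term.\<close>

lemma objective_expansion:
  assumes T: "T \<in> feasible \<sigma> r p" "solves_system T" and U: "U \<in> feasible \<sigma> r p"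
  shows "objective r N X Y Z \<nu> U = objective r N X Y Z \<nu> T +
    1/2 * (\<Sum>s\<in>{1..N}. frob_sq (X s * C U s * Y s - X s * C T s * Y s))"
proof -
  have c: "T \<in> carrier_tensor3 r r p" "U \<in> carrier_tensor3 r r p"
    using T(1) U by (simp_all add: feasible_def)
  \<comment> \<open>The cross term is kept as a difference of two inner products, so that the
    first-order condition can be applied with directions \<open>U\<close> and \<open>T\<close> and
    no difference tensor has to be formed.\<close>
  have "frob_sq (R U s) = frob_sq (R T s) -
      2 * (frob_inner (R T s) (X s * C U s * Y s) - frob_inner (R T s) (X s * C T s * Y s)) +
      frob_sq (X s * C U s * Y s - X s * C T s * Y s)" if s: "s \<in> {1..N}" for s
  proof -
    note d = PQW_carrier(4)[OF s, of T] PQW_carrier(4)[OF s, of U]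
    note e = carrier_matD[OF d(1)] carrier_matD[OF d(2)] carrier_matD[OF Z[OF s]]
    have "R U s = R T s - (X s * C U s * Y s - X s * C T s * Y s)"
      unfolding R_def using e
      by (intro eq_matI) (auto simp del: index_mult_mat assoc_mult_mat)
    moreover have "frob_inner (R T s) (X s * C U s * Y s - X s * C T s * Y s) =
        frob_inner (R T s) (X s * C U s * Y s) - frob_inner (R T s) (X s * C T s * Y s)"
      unfolding frob_inner_def sum_subtractf[symmetric] R_def using e
      by (intro sum.cong refl) (auto simp: algebra_simps simp del: index_mult_mat assoc_mult_mat)
    ultimately show ?thesis
      using frob_sq_minus[OF PQW_carrier(5)[OF s] minus_carrier_mat[OF d(1)]] by simp
  qed
  then have "(\<Sum>s\<in>{1..N}. frob_sq (R U s)) = (\<Sum>s\<in>{1..N}. frob_sq (R T s)) -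
      2 * ((\<Sum>s\<in>{1..N}. frob_inner (R T s) (X s * C U s * Y s)) -
        (\<Sum>s\<in>{1..N}. frob_inner (R T s) (X s * C T s * Y s))) +
      (\<Sum>s\<in>{1..N}. frob_sq (X s * C U s * Y s - X s * C T s * Y s))"
    by (simp add: sum.distrib sum_subtractf sum_distrib_left del: assoc_mult_mat)
  then show ?thesis
    unfolding sum_frob_inner_eq_0[OF T U] sum_frob_inner_eq_0[OF T T(1)] objective_eq by simp
qed

lemma is_arg_min_if_solves_system:
  assumes "T \<in> feasible \<sigma> r p" "solves_system T"
  shows "is_arg_min (objective r N X Y Z \<nu>) (\<lambda>U. U \<in> feasible \<sigma> r p) T"
  unfolding is_arg_min_linorder
proof (intro conjI allI impI)
  fix U assume "U \<in> feasible \<sigma> r p"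
  note e = objective_expansion[OF assms this]
  show "objective r N X Y Z \<nu> T \<le> objective r N X Y Z \<nu> U"
    unfolding e by (simp add: sum_nonneg frob_sq_nonneg)
qed (rule assms(1))

text \<open>Feasible tensors are exactly those with entries \<open>c x a b + \<sigma> * c x b a\<close>; the normal equations
  of the least-squares problem in the free variables \<open>c\<close> are the linear system.\<close>

lemma feasible_solution_exists:
  obtains T where "T \<in> feasible \<sigma> r p" "solves_system T"
proof -
  \<comment> \<open>Column \<open>(x,a,b)\<close> of the design matrix lists, over all samples and
    entries \<open>(s,i,j)\<close>, the model values of the feasible tensor whose only nonzero slice
    is \<open>x\<close>, namely the matrix unit at \<open>(a,b)\<close> plus \<sigma> times the one
    at \<open>(b,a)\<close>. These tensors are linearly dependent in general, which the normal
    equations tolerate.\<close>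
  define M where "M = (\<lambda>(s,i,j) (x,a,b).
    \<nu> s $ x * (X s $$ (i,a) * Y s $$ (b,j) + \<sigma> * (X s $$ (i,b) * Y s $$ (a,j))))"
  define z where "z = (\<lambda>(s,i,j). Z s $$ (i,j))"
  let ?I = "{1..N} \<times> {..<r} \<times> {..<n}" and ?J = "{..<p} \<times> {..<r} \<times> {..<r}"
  obtain c where c: "\<And>k. k \<in> ?J \<Longrightarrow> (\<Sum>i\<in>?I. (z i - (\<Sum>j\<in>?J. c j * M i j)) * M i k) = 0"
    using normal_equations_solvable[of ?I ?J z M] by auto
  define T where "T = vec p (\<lambda>x. mat r r (\<lambda>(a,b). c (x,a,b) + \<sigma> * c (x,b,a)))"
  have T: "T \<in> carrier_tensor3 r r p" by (simp add: T_def carrier_tensor3_def)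
  have Tx: "T $ x $$ (a,b) = c (x,a,b) + \<sigma> * c (x,b,a)" if "x < p" "a < r" "b < r" for x a b
    using that by (simp add: T_def)
  have "\<sigma> * (\<sigma> * t) = t" for t unfolding mult.assoc[symmetric] sign_sq by simp
  then have feas: "T \<in> feasible \<sigma> r p"
    using T by (simp add: feasible_iff[OF sign_sq] Tx ring_distribs)
  have res: "z (s,i,j) - (\<Sum>k\<in>?J. c k * M (s,i,j) k) = R T s $$ (i,j)"
    if s: "s \<in> {1..N}" and i: "i < r" and j: "j < n" for s i j
  proof -
    let ?f = "\<lambda>x a b. \<nu> s $ x * X s $$ (i,a) * Y s $$ (b,j)"
    have "(X s * C T s * Y s) $$ (i,j) = (\<Sum>a<r. \<Sum>b<r. \<Sum>x<p. (c (x,a,b) + \<sigma> * c (x,b,a)) * ?f x a b)"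
      unfolding index_mult_mat_triple[OF X[OF s] C_carrier Y[OF s] i j]
      by (intro sum.cong refl)
        (auto simp: C_def index_contract[OF T] Tx sum_distrib_left sum_distrib_right mult_ac intro!: sum.cong)
    also have "\<dots> = (\<Sum>a<r. \<Sum>b<r. \<Sum>x<p. c (x,a,b) * ?f x a b) +
        (\<Sum>a<r. \<Sum>b<r. \<Sum>x<p. c (x,b,a) * (\<sigma> * ?f x a b))"
      unfolding sum.distrib[symmetric] by (intro sum.cong refl) (simp add: algebra_simps)
    \<comment> \<open>Exchanging the roles of \<open>a\<close> and \<open>b\<close> moves the
      \<sigma>-transposition from the tensor to the design matrix.\<close>
    also have "(\<Sum>a<r. \<Sum>b<r. \<Sum>x<p. c (x,b,a) * (\<sigma> * ?f x a b)) =
        (\<Sum>a<r. \<Sum>b<r. \<Sum>x<p. c (x,a,b) * (\<sigma> * ?f x b a))"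
      by (rule sum.swap)
    also have "(\<Sum>a<r. \<Sum>b<r. \<Sum>x<p. c (x,a,b) * ?f x a b) + \<dots> =
        (\<Sum>a<r. \<Sum>b<r. \<Sum>x<p. c (x,a,b) * M (s,i,j) (x,a,b))"
      unfolding sum.distrib[symmetric] by (intro sum.cong refl) (simp add: M_def algebra_simps)
    also have "\<dots> = (\<Sum>x<p. \<Sum>a<r. \<Sum>b<r. c (x,a,b) * M (s,i,j) (x,a,b))"
      by (subst sum_swap3[symmetric], rule sum.cong[OF refl], rule sum.swap)
    also have "\<dots> = (\<Sum>k\<in>?J. c k * M (s,i,j) k)"
      by (simp add: sum.cartesian_product' split_def)
    finally have "(X s * C T s * Y s) $$ (i,j) = (\<Sum>k\<in>?J. c k * M (s,i,j) k)" .
    moreover have "R T s $$ (i,j) = Z s $$ (i,j) - (X s * C T s * Y s) $$ (i,j)"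
      unfolding R_def using carrier_matD[OF PQW_carrier(4)[OF s, of T]] i j by simp
    ultimately show ?thesis by (simp add: z_def)
  qed
  have "neg_grad T x $$ (a,b) + \<sigma> * neg_grad T x $$ (b,a) = 0" if x: "x < p" and ab: "a < r" "b < r" for x a b
  proof -
    have H: "H T s $$ (a,b) = (\<Sum>i<r. \<Sum>j<n. R T s $$ (i,j) * (X s $$ (i,a) * Y s $$ (b,j)))"
      if s: "s \<in> {1..N}" and ab: "a < r" "b < r" for s a b
    proof -
      have t: "transpose_mat (X s) \<in> carrier_mat r r" "transpose_mat (Y s) \<in> carrier_mat n r"
        using X[OF s] Y[OF s] by auto
      show ?thesis
        unfolding H_def index_mult_mat_triple[OF t(1) PQW_carrier(5)[OF s] t(2) ab]
        using carrier_matD[OF X[OF s]] carrier_matD[OF Y[OF s]] ab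
        by (intro sum.cong refl) (simp add: mult_ac)
    qed
    \<comment> \<open>Pairing the residuals with column \<open>(x,a,b)\<close> applies the adjoint
      of the model map and symmetrizes with \<sigma>, so each normal equation is one entry of the
      gradient condition.\<close>
    have "0 = (\<Sum>i\<in>?I. (z i - (\<Sum>j\<in>?J. c j * M i j)) * M i (x,a,b))"
      using c[of "(x,a,b)"] x ab by simp
    also have "\<dots> = (\<Sum>k\<in>?I. (case k of (s,i,j) \<Rightarrow> R T s $$ (i,j)) * M k (x,a,b))"
    proof (rule sum.cong[OF refl])
      fix k assume "k \<in> ?I"
      then obtain s i j where k: "k = (s,i,j)" and s: "s \<in> {1..N}" and ij: "i < r" "j < n" by auto
      show "(z k - (\<Sum>j\<in>?J. c j * M k j)) * M k (x,a,b) =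
          (case k of (s,i,j) \<Rightarrow> R T s $$ (i,j)) * M k (x,a,b)"
        unfolding k res[OF s ij] by simp
    qed
    also have "\<dots> = (\<Sum>s\<in>{1..N}. \<Sum>i<r. \<Sum>j<n. R T s $$ (i,j) * M (s,i,j) (x,a,b))"
      unfolding sum.cartesian_product' by simp
    also have "\<dots> = (\<Sum>s\<in>{1..N}. \<nu> s $ x * (H T s $$ (a,b) + \<sigma> * H T s $$ (b,a)))"
    proof (rule sum.cong[OF refl])
      fix s assume s: "s \<in> {1..N}"
      show "(\<Sum>i<r. \<Sum>j<n. R T s $$ (i,j) * M (s,i,j) (x,a,b)) =
          \<nu> s $ x * (H T s $$ (a,b) + \<sigma> * H T s $$ (b,a))"
        unfolding H[OF s ab] H[OF s ab(2,1)] sum_distrib_left sum.distrib[symmetric]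
        by (intro sum.cong refl) (simp add: M_def algebra_simps)
    qed
    also have "\<dots> = neg_grad T x $$ (a,b) + \<sigma> * neg_grad T x $$ (b,a)"
      using ab by (simp add: neg_grad_def distrib_left sum.distrib sum_distrib_left mult_ac)
    finally show ?thesis by simp
  qed
  then have "solves_system T" unfolding solves_system_feasible_iff[OF feas] by blast
  with feas show thesis by (rule that)
qed

lemma solves_system_if_is_arg_min:
  assumes "is_arg_min (objective r N X Y Z \<nu>) (\<lambda>U. U \<in> feasible \<sigma> r p) T"
  shows "T \<in> feasible \<sigma> r p" "solves_system T"
proof -
  show T: "T \<in> feasible \<sigma> r p" using assms by (simp add: is_arg_min_def)
  \<comment> \<open>The expansion is available only around a solution of the system, so
    \<open>T\<close> is compared with such an \<open>S\<close>.\<close>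
  obtain S where S: "S \<in> feasible \<sigma> r p" "solves_system S" by (rule feasible_solution_exists)
  have "objective r N X Y Z \<nu> T \<le> objective r N X Y Z \<nu> S"
    using assms S(1) unfolding is_arg_min_linorder by blast
  then have "(\<Sum>s\<in>{1..N}. frob_sq (X s * C T s * Y s - X s * C S s * Y s)) \<le> 0"
    unfolding objective_expansion[OF S T] by simp
  then have "(\<Sum>s\<in>{1..N}. frob_sq (X s * C T s * Y s - X s * C S s * Y s)) = 0"
    by (intro antisym sum_nonneg frob_sq_nonneg)
  then have z: "frob_sq (X s * C T s * Y s - X s * C S s * Y s) = 0" if "s \<in> {1..N}" for s
    using that by (subst (asm) sum_nonneg_eq_0_iff) (auto simp: frob_sq_nonneg)
  \<comment> \<open>The residual and hence \<open>H\<close> depend on the tensor only through the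
    model values, which coincide for \<open>T\<close> and \<open>S\<close> although the tensors may
    differ.\<close>
  have "H T s = H S s" if s: "s \<in> {1..N}" for s
  proof -
    note d = PQW_carrier(4)[OF s, of T] PQW_carrier(4)[OF s, of S]
    note e = carrier_matD[OF d(1)] carrier_matD[OF d(2)]
    have "X s * C T s * Y s - X s * C S s * Y s = 0\<^sub>m r n"
      using z[OF s] frob_sq_eq_0_iff[OF minus_carrier_mat[OF d(2)]] by blast
    then have "(X s * C T s * Y s - X s * C S s * Y s) $$ (i,j) = 0" if "i < r" "j < n" for i j
      using that by simp
    then have "X s * C T s * Y s = X s * C S s * Y s"
      using e by (intro eq_matI) (auto simp del: index_mult_mat assoc_mult_mat)
    then show ?thesis by (simp only: H_def R_def)
  qed
  then have "neg_grad T = neg_grad S" unfolding neg_grad_def by (intro ext cong_mat) auto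
  with S(2) show "solves_system T"
    unfolding solves_system_feasible_iff[OF T] solves_system_feasible_iff[OF S(1)] by simp
qed

end

theorem theorem3p1:
  fixes r p Nt Ns :: nat and \<sigma> :: real
    and X Y Z :: "nat \<Rightarrow> real mat" and \<nu> :: "nat \<Rightarrow> real vec"
  assumes "r > 0" "p > 0" "Nt > 0" "Ns > 0"
    and "\<sigma> \<in> {1, -1}"
    and "\<And>s. s \<in> {1..Ns} \<Longrightarrow> X s \<in> carrier_mat r r"
    and "\<And>s. s \<in> {1..Ns} \<Longrightarrow> Y s \<in> carrier_mat r Nt"
    and "\<And>s. s \<in> {1..Ns} \<Longrightarrow> Z s \<in> carrier_mat r Nt"
    and "\<And>s. s \<in> {1..Ns} \<Longrightarrow> \<nu> s \<in> carrier_vec p"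
  shows "convex_problem (objective r Ns X Y Z \<nu>) (feasible \<sigma> r p) \<and>
    (\<exists>T\<in>carrier_tensor3 r r p.
       system_mat r p Ns X Y \<nu> *\<^sub>v vec_tensor3 r r T = system_rhs \<sigma> r p Ns X Y Z \<nu>) \<and>
    (\<forall>T\<in>carrier_tensor3 r r p.
       system_mat r p Ns X Y \<nu> *\<^sub>v vec_tensor3 r r T = system_rhs \<sigma> r p Ns X Y Z \<nu> \<longrightarrow>
       is_arg_min (objective r Ns X Y Z \<nu>) (\<lambda>U. U \<in> feasible \<sigma> r p) (sym_part \<sigma> T)) \<and>
    (\<forall>T. is_arg_min (objective r Ns X Y Z \<nu>) (\<lambda>U. U \<in> feasible \<sigma> r p) T \<longleftrightarrow>
       T \<in> feasible \<sigma> r p \<and>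
       system_mat r p Ns X Y \<nu> *\<^sub>v vec_tensor3 r r T = system_rhs \<sigma> r p Ns X Y Z \<nu>)"
proof -
  have "\<sigma> * \<sigma> = 1" using assms(5) by auto
  then interpret tensor_regression r p Nt Ns \<sigma> X Y Z \<nu>
    using assms by unfold_locales
  show ?thesis
  proof (intro conjI ballI allI impI iffI)
    show "convex_problem (objective r Ns X Y Z \<nu>) (feasible \<sigma> r p)"
      by (rule convex_problem_objective)
    show "\<exists>T\<in>carrier_tensor3 r r p. solves_system T"
      using feasible_solution_exists unfolding feasible_def by blast
    show "is_arg_min (objective r Ns X Y Z \<nu>) (\<lambda>U. U \<in> feasible \<sigma> r p) (sym_part \<sigma> T)"
      if "T \<in> carrier_tensor3 r r p" "solves_system T" for T
      using that by (intro is_arg_min_if_solves_system sym_part_feasible solves_system_sym_part sign_sq)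
    show "T \<in> feasible \<sigma> r p" "solves_system T"
      if "is_arg_min (objective r Ns X Y Z \<nu>) (\<lambda>U. U \<in> feasible \<sigma> r p) T" for T
      using that by (fact solves_system_if_is_arg_min)+
    show "is_arg_min (objective r Ns X Y Z \<nu>) (\<lambda>U. U \<in> feasible \<sigma> r p) T"
      if "T \<in> feasible \<sigma> r p \<and> solves_system T" for T
      using that by (blast intro: is_arg_min_if_solves_system)
  qed
qed

end
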